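(* Consider the system $\dot x_n=c_{n1}x_1^3+c_{n2}x_1^2x_2+c_{n3}x_1x_2^2+c_{n4}x_2^3$, $n=1,2$, with $8$ time-independent (possibly complex) coefficients $c_{n\ell}$ having generic values (except for satisfying the constraints below). If the $8$ coefficients $c_{n\ell}$ are given by the $7$-parameter parametrization described in the context, then they are required to satisfy the following two constraints. First constraint, in any one of the three versions $$(c_{12}c_{22}-3c_{13}c_{21})\,[c_{12}c_{23}-c_{13}c_{22}-c_{23}^2+3c_{22}c_{24}]=(c_{13}c_{23}-3c_{14}c_{22})\,[3(c_{11}c_{22}-c_{12}c_{21}+c_{21}c_{23})-c_{22}^2],$$ $$(c_{13}c_{23}-3c_{14}c_{22})\,[3(c_{11}c_{23}-c_{13}c_{21})+9c_{21}c_{24}-c_{22}c_{23}]=(c_{12}c_{23}-9c_{14}c_{21})\,[c_{12}c_{23}-c_{13}c_{22}-c_{23}^2+3c_{22}c_{24}],$$ $$(c_{12}c_{23}-9c_{14}c_{21})\,[3(c_{11}c_{22}-c_{12}c_{21}+c_{21}c_{23})-c_{22}^2]=(c_{12}c_{22}-3c_{13}c_{21})\,[3(c_{11}c_{23}-c_{13}c_{21})+9c_{21}c_{24}-c_{22}c_{23}],$$ which are equivalent to each other, i.e. together they entail only one constraint. Second constraint: $$[c_{12}(c_{13}-3c_{24})+3c_{14}(-3c_{11}+c_{22})]\,[3c_{21}(c_{13}-3c_{24})+c_{23}(c_{22}-3c_{11})]=(c_{12}c_{23}-9c_{14}c_{21})^2.$$ The second constraint is not equivalent to the first. Moreover, if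 the $8$ coefficients $c_{n\ell}$ satisfy these two constraints, this is sufficient to guarantee that the system possesses the solution of its initial-values problem described in the context.
   Context: Parametrization: in terms of $7$ parameters $a_1,a_2,b_1,b_2,\gamma_1,\gamma_2,\gamma_3$, with none of $a_1,a_2,b_1,b_2$ vanishing, and with $c=a_1b_2-a_2b_1$, $$c_{11}=\frac{a_1^3b_2-a_2K_1}{c},\quad c_{21}=\frac{-a_1^3b_1+a_1K_1}{c},\quad c_{12}=\frac{3a_1^2a_2b_2-a_2K_2}{c},\quad c_{22}=\frac{-3a_1^2a_2b_1+a_1K_2}{c},$$ $$c_{13}=\frac{3a_1a_2^2b_2-a_2K_3}{c},\quad c_{23}=\frac{-3a_1a_2^2b_1+a_1K_3}{c},\quad c_{14}=\frac{a_2^3b_2-a_2K_4}{c},\quad c_{24}=\frac{-a_2^3b_1+a_1K_4}{c},$$ with $$K_1=\gamma_1a_1b_1^2+\gamma_2a_1^2b_1+\gamma_3a_1^3+b_1^3,$$ $$K_2=\gamma_1(a_2b_1^2+2a_1b_1b_2)+\gamma_2(a_1^2b_2+2a_1a_2b_1)+3\gamma_3a_1^2a_2+3b_1^2b_2,$$ $$K_3=\gamma_1(a_1b_2^2+2a_2b_1b_2)+\gamma_2(a_2^2b_1+2a_1a_2b_2)+3\gamma_3a_1a_2^2+3b_1b_2^2,$$ $$K_4=\gamma_1a_2b_2^2+\gamma_2a_2^2b_2+\gamma_3a_2^3+b_2^3.$$ Solution associated with this parametrization: $x_1(t)=[b_2y(t)-a_2w(t)]/c$, $x_2(t)=-[b_1y(t)-a_1w(t)]/c$,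 where $y(0)=a_1x_1(0)+a_2x_2(0)$, $w(0)=b_1x_1(0)+b_2x_2(0)$, $y(t)=y(0)\{1-2[y(0)]^2t\}^{-1/2}$, $w(t)=u(t)y(t)$, $u(0)=w(0)/y(0)$, and $u(t)$ is defined implicitly by $$\prod_{j=1}^3\left[\frac{u(t)-u_j}{u(0)-u_j}\right]^{-2\lambda_j}=1-2[y(0)]^2t,$$ with $u_1,u_2,u_3$ the roots of $u^3+\gamma_1u^2+(\gamma_2-1)u+\gamma_3$ and $\lambda_j=\big[\prod_{\ell\ne j}(u_j-u_\ell)\big]^{-1}$. The dot denotes differentiation with respect to the independent variable $t$. *)

theory Defs
  imports "HOL-Analysis.Analysis" "HOL-Computational_Algebra.Computational_Algebra"
begin

(* The coefficient c_{nl} is written c n l; only n in {1,2} and l in {1,2,3,4} matter. *)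

definition cubic_rhs ::
  "(nat \<Rightarrow> nat \<Rightarrow> complex) \<Rightarrow> nat \<Rightarrow> complex \<Rightarrow> complex \<Rightarrow> complex" where
  "cubic_rhs c n x1 x2 =
     c n 1 * x1 ^ 3 + c n 2 * x1\<^sup>2 * x2 + c n 3 * x1 * x2\<^sup>2 + c n 4 * x2 ^ 3"

(* Differentiation within S covers both real time (S an interval of the real line, embedded in
   the complex plane) and complex time (S a domain). *)
definition solves_ivp ::
  "(nat \<Rightarrow> nat \<Rightarrow> complex) \<Rightarrow> complex \<Rightarrow> complex \<Rightarrow> complex set \<Rightarrow>
   (complex \<Rightarrow> complex) \<Rightarrow> (complex \<Rightarrow> complex) \<Rightarrow> bool" where
  "solves_ivp c x10 x20 S x1 x2 \<longleftrightarrow>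
     x1 0 = x10 \<and> x2 0 = x20 \<and>
     (\<forall>t\<in>S. (x1 has_field_derivative cubic_rhs c 1 (x1 t) (x2 t)) (at t within S) \<and>
            (x2 has_field_derivative cubic_rhs c 2 (x1 t) (x2 t)) (at t within S))"

definition K1 :: "complex \<Rightarrow> complex \<Rightarrow> complex \<Rightarrow> complex \<Rightarrow> complex \<Rightarrow> complex \<Rightarrow> complex \<Rightarrow> complex" where
  "K1 a1 a2 b1 b2 \<gamma>1 \<gamma>2 \<gamma>3 = \<gamma>1 * a1 * b1\<^sup>2 + \<gamma>2 * a1\<^sup>2 * b1 + \<gamma>3 * a1 ^ 3 + b1 ^ 3"

definition K2 :: "complex \<Rightarrow> complex \<Rightarrow> complex \<Rightarrow> complex \<Rightarrow> complex \<Rightarrow> complex \<Rightarrow> complex \<Rightarrow> complex" where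
  "K2 a1 a2 b1 b2 \<gamma>1 \<gamma>2 \<gamma>3 =
     \<gamma>1 * (a2 * b1\<^sup>2 + 2 * a1 * b1 * b2) + \<gamma>2 * (a1\<^sup>2 * b2 + 2 * a1 * a2 * b1)
     + 3 * \<gamma>3 * a1\<^sup>2 * a2 + 3 * b1\<^sup>2 * b2"

definition K3 :: "complex \<Rightarrow> complex \<Rightarrow> complex \<Rightarrow> complex \<Rightarrow> complex \<Rightarrow> complex \<Rightarrow> complex \<Rightarrow> complex" where
  "K3 a1 a2 b1 b2 \<gamma>1 \<gamma>2 \<gamma>3 =
     \<gamma>1 * (a1 * b2\<^sup>2 + 2 * a2 * b1 * b2) + \<gamma>2 * (a2\<^sup>2 * b1 + 2 * a1 * a2 * b2)
     + 3 * \<gamma>3 * a1 * a2\<^sup>2 + 3 * b1 * b2\<^sup>2"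

definition K4 :: "complex \<Rightarrow> complex \<Rightarrow> complex \<Rightarrow> complex \<Rightarrow> complex \<Rightarrow> complex \<Rightarrow> complex \<Rightarrow> complex" where
  "K4 a1 a2 b1 b2 \<gamma>1 \<gamma>2 \<gamma>3 = \<gamma>1 * a2 * b2\<^sup>2 + \<gamma>2 * a2\<^sup>2 * b2 + \<gamma>3 * a2 ^ 3 + b2 ^ 3"

definition admissible_params :: "complex \<Rightarrow> complex \<Rightarrow> complex \<Rightarrow> complex \<Rightarrow> bool" where
  "admissible_params a1 a2 b1 b2 \<longleftrightarrow>
     a1 \<noteq> 0 \<and> a2 \<noteq> 0 \<and> b1 \<noteq> 0 \<and> b2 \<noteq> 0 \<and> a1 * b2 - a2 * b1 \<noteq> 0"

definition parametrized ::
  "(nat \<Rightarrow> nat \<Rightarrow> complex) \<Rightarrow> complex \<Rightarrow> complex \<Rightarrow> complex \<Rightarrow> complex \<Rightarrow>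
   complex \<Rightarrow> complex \<Rightarrow> complex \<Rightarrow> bool" where
  "parametrized c a1 a2 b1 b2 \<gamma>1 \<gamma>2 \<gamma>3 \<longleftrightarrow>
     (let d = a1 * b2 - a2 * b1;
          k1 = K1 a1 a2 b1 b2 \<gamma>1 \<gamma>2 \<gamma>3; k2 = K2 a1 a2 b1 b2 \<gamma>1 \<gamma>2 \<gamma>3;
          k3 = K3 a1 a2 b1 b2 \<gamma>1 \<gamma>2 \<gamma>3; k4 = K4 a1 a2 b1 b2 \<gamma>1 \<gamma>2 \<gamma>3
      in c 1 1 = (a1 ^ 3 * b2 - a2 * k1) / d \<and>
         c 2 1 = (- (a1 ^ 3) * b1 + a1 * k1) / d \<and>
         c 1 2 = (3 * a1\<^sup>2 * a2 * b2 - a2 * k2) / d \<and>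
         c 2 2 = (- 3 * a1\<^sup>2 * a2 * b1 + a1 * k2) / d \<and>
         c 1 3 = (3 * a1 * a2\<^sup>2 * b2 - a2 * k3) / d \<and>
         c 2 3 = (- 3 * a1 * a2\<^sup>2 * b1 + a1 * k3) / d \<and>
         c 1 4 = (a2 ^ 3 * b2 - a2 * k4) / d \<and>
         c 2 4 = (- (a2 ^ 3) * b1 + a1 * k4) / d)"

definition constraint1_v1 :: "(nat \<Rightarrow> nat \<Rightarrow> complex) \<Rightarrow> bool" where
  "constraint1_v1 c \<longleftrightarrow>
     (c 1 2 * c 2 2 - 3 * c 1 3 * c 2 1)
       * (c 1 2 * c 2 3 - c 1 3 * c 2 2 - (c 2 3)\<^sup>2 + 3 * c 2 2 * c 2 4)
     = (c 1 3 * c 2 3 - 3 * c 1 4 * c 2 2)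
       * (3 * (c 1 1 * c 2 2 - c 1 2 * c 2 1 + c 2 1 * c 2 3) - (c 2 2)\<^sup>2)"

definition constraint1_v2 :: "(nat \<Rightarrow> nat \<Rightarrow> complex) \<Rightarrow> bool" where
  "constraint1_v2 c \<longleftrightarrow>
     (c 1 3 * c 2 3 - 3 * c 1 4 * c 2 2)
       * (3 * (c 1 1 * c 2 3 - c 1 3 * c 2 1) + 9 * c 2 1 * c 2 4 - c 2 2 * c 2 3)
     = (c 1 2 * c 2 3 - 9 * c 1 4 * c 2 1)
       * (c 1 2 * c 2 3 - c 1 3 * c 2 2 - (c 2 3)\<^sup>2 + 3 * c 2 2 * c 2 4)"

definition constraint1_v3 :: "(nat \<Rightarrow> nat \<Rightarrow> complex) \<Rightarrow> bool" where
  "constraint1_v3 c \<longleftrightarrow>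
     (c 1 2 * c 2 3 - 9 * c 1 4 * c 2 1)
       * (3 * (c 1 1 * c 2 2 - c 1 2 * c 2 1 + c 2 1 * c 2 3) - (c 2 2)\<^sup>2)
     = (c 1 2 * c 2 2 - 3 * c 1 3 * c 2 1)
       * (3 * (c 1 1 * c 2 3 - c 1 3 * c 2 1) + 9 * c 2 1 * c 2 4 - c 2 2 * c 2 3)"

definition constraint2 :: "(nat \<Rightarrow> nat \<Rightarrow> complex) \<Rightarrow> bool" where
  "constraint2 c \<longleftrightarrow>
     (c 1 2 * (c 1 3 - 3 * c 2 4) + 3 * c 1 4 * (- 3 * c 1 1 + c 2 2))
       * (3 * c 2 1 * (c 1 3 - 3 * c 2 4) + c 2 3 * (c 2 2 - 3 * c 1 1))
     = (c 1 2 * c 2 3 - 9 * c 1 4 * c 2 1)\<^sup>2"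

(* Dehomogenization, with s = x1 / x2, of the binary form x1 * X2 - x2 * X1, where
   X_n = cubic_rhs c n x1 x2; its roots are the lines through the origin invariant under the flow. *)
definition invariant_lines_poly :: "(nat \<Rightarrow> nat \<Rightarrow> complex) \<Rightarrow> complex poly" where
  "invariant_lines_poly c =
     [: - c 1 4, c 2 4 - c 1 3, c 2 3 - c 1 2, c 2 2 - c 1 1, c 2 1 :]"

(* Explicit meaning of "generic values". All four conditions are Zariski open, and a general choice
   of the parameters produces coefficients satisfying them.
   - c_{21}, c_{22}, c_{23} do not vanish: the three versions of the first constraint are the
     vanishing of one 3x3 determinant multiplied by 3 c_{21}, c_{22}, c_{23} respectively.
   - c_{12} c_{23} - 9 c_{14} c_{21} does not vanish: under the second constraint, which is a
     resultant of two quadratics in a_2 / a_1, it says that these are not proportional and that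
     their common root is neither zero nor at infinity.
   - The two right-hand sides are not proportional (otherwise a linear combination of x1, x2 is
     conserved, which would force a_1 = a_2 = 0).
   - The four invariant lines are distinct. For parametrized coefficients they are y = 0 and
     w = u_j y, j = 1,2,3, so this is the distinctness of u_1, u_2, u_3, without which the numbers
     lambda_j are undefined. *)
definition generic_coeffs :: "(nat \<Rightarrow> nat \<Rightarrow> complex) \<Rightarrow> bool" where
  "generic_coeffs c \<longleftrightarrow>
     c 2 1 \<noteq> 0 \<and> c 2 2 \<noteq> 0 \<and> c 2 3 \<noteq> 0 \<and>
     c 1 2 * c 2 3 - 9 * c 1 4 * c 2 1 \<noteq> 0 \<and>
     (\<exists>i\<in>{1..4}. \<exists>j\<in>{1..4}. c 1 i * c 2 j \<noteq> c 1 j * c 2 i) \<and>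
     rsquarefree (invariant_lines_poly c)"

(* The roots are u 1, u 2, u 3, listed with multiplicity. *)
definition cubic_roots :: "complex \<Rightarrow> complex \<Rightarrow> complex \<Rightarrow> (nat \<Rightarrow> complex) \<Rightarrow> bool" where
  "cubic_roots \<gamma>1 \<gamma>2 \<gamma>3 u \<longleftrightarrow>
     [: \<gamma>3, \<gamma>2 - 1, \<gamma>1, 1 :] = (\<Prod>j\<in>{1,2,3}. [: - u j, 1 :])"

definition lam :: "(nat \<Rightarrow> complex) \<Rightarrow> nat \<Rightarrow> complex" where
  "lam u j = inverse (\<Prod>l\<in>{1,2,3} - {j}. u j - u l)"

(* For f 0 = 1, g is the branch on S of the multivalued power f^p obtained by continuation from
   the value 1 at t = 0. Near t = 0 it is the principal value f t powr p; unlike the principal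
   value it does not jump when f t crosses the negative real axis. *)
definition power_branch ::
  "complex set \<Rightarrow> (complex \<Rightarrow> complex) \<Rightarrow> complex \<Rightarrow> (complex \<Rightarrow> complex) \<Rightarrow> bool" where
  "power_branch S f p g \<longleftrightarrow>
     (\<exists>L. continuous_on S L \<and> L 0 = 0 \<and> (\<forall>t\<in>S. exp (L t) = f t \<and> g t = exp (p * L t)))"

definition described_solution ::
  "complex \<Rightarrow> complex \<Rightarrow> complex \<Rightarrow> complex \<Rightarrow> (nat \<Rightarrow> complex) \<Rightarrow> complex \<Rightarrow> complex \<Rightarrow>
   complex set \<Rightarrow> (complex \<Rightarrow> complex) \<Rightarrow> (complex \<Rightarrow> complex) \<Rightarrow> bool" where
  "described_solution a1 a2 b1 b2 uroot x10 x20 S x1 x2 \<longleftrightarrow>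
     (\<exists>y w u r q.
        let d = a1 * b2 - a2 * b1; y0 = a1 * x10 + a2 * x20; w0 = b1 * x10 + b2 * x20 in
        power_branch S (\<lambda>t. 1 - 2 * y0\<^sup>2 * t) (- 1 / 2) r \<and>
        (\<forall>t\<in>S. y t = y0 * r t) \<and>
        u 0 = w0 / y0 \<and>
        (\<forall>j\<in>{1,2,3}. power_branch S (\<lambda>t. (u t - uroot j) / (u 0 - uroot j))
                          (- 2 * lam uroot j) (q j)) \<and>
        (\<forall>t\<in>S. (\<Prod>j\<in>{1,2,3::nat}. q j t) = 1 - 2 * y0\<^sup>2 * t) \<and>
        (\<forall>t\<in>S. w t = u t * y t) \<and>
        (\<forall>t\<in>S. x1 t = (b2 * y t - a2 * w t) / d \<and> x2 t = - (b1 * y t - a1 * w t) / d))"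

(* S is any connected set of times containing 0. The initial data are those for which u(0) and the
   implicit relation make sense. *)
definition has_described_ivp_solution :: "(nat \<Rightarrow> nat \<Rightarrow> complex) \<Rightarrow> bool" where
  "has_described_ivp_solution c \<longleftrightarrow>
     (\<exists>a1 a2 b1 b2 \<gamma>1 \<gamma>2 \<gamma>3 uroot.
        admissible_params a1 a2 b1 b2 \<and>
        parametrized c a1 a2 b1 b2 \<gamma>1 \<gamma>2 \<gamma>3 \<and>
        cubic_roots \<gamma>1 \<gamma>2 \<gamma>3 uroot \<and> inj_on uroot {1,2,3} \<and>
        (\<forall>x10 x20.
           a1 * x10 + a2 * x20 \<noteq> 0 \<and>
           (\<forall>j\<in>{1,2,3}. (b1 * x10 + b2 * x20) / (a1 * x10 + a2 * x20) \<noteq> uroot j) \<longrightarrow>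
           (\<exists>\<epsilon>>0. \<exists>x1 x2. described_solution a1 a2 b1 b2 uroot x10 x20 (ball 0 \<epsilon>) x1 x2) \<and>
           (\<forall>S x1 x2. connected S \<and> 0 \<in> S \<and>
              described_solution a1 a2 b1 b2 uroot x10 x20 S x1 x2 \<longrightarrow>
              solves_ivp c x10 x20 S x1 x2)))"

(* Genericity is compatible with both constraints. *)
lemma generic_constrained_exists:
  "\<exists>c. generic_coeffs c \<and> constraint1_v1 c \<and> constraint2 c"
proof -
  define c :: "nat \<Rightarrow> nat \<Rightarrow> complex" where
    "c = (\<lambda>n l. if n = 1 then (if l = 1 then -1 else if l = 2 then 14 else if l = 3 then -21 else 12)
               else (if l = 1 then 2 else if l = 2 then -11 else if l = 3 then 24 else -11))"
  have p: "invariant_lines_poly c = [: -12, 10, 10, -10, 2 :]"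
    by (simp add: invariant_lines_poly_def c_def)
  have "\<not> (poly [: -12, 10, 10, -10, 2 :] s = 0 \<and> poly (pderiv [: -12, 10, 10, -10, 2 :]) s = 0)"
    for s :: complex
  proof
    assume *: "poly [: -12, 10, 10, -10, 2 :] s = 0 \<and> poly (pderiv [: -12, 10, 10, -10, 2 :]) s = 0"
    have "poly [: -12, 10, 10, -10, 2 :] s = 2 * (s + 1) * (s - 1) * (s - 2) * (s - 3)"
      by (simp add: algebra_simps)
    with * have "2 * (s + 1) * (s - 1) * (s - 2) * (s - 3) = 0"
      by metis
    then have "s = -1 \<or> s = 1 \<or> s = 2 \<or> s = 3"
      unfolding mult_eq_0_iff by (auto simp: eq_neg_iff_add_eq_0)
    with * show False
      by (auto simp: pderiv_pCons)
  qed
  then have "rsquarefree (invariant_lines_poly c)"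
    unfolding p rsquarefree_roots by blast
  moreover have "c 1 1 * c 2 2 \<noteq> c 1 2 * c 2 1"
    by (simp add: c_def)
  then have "\<exists>i\<in>{1..4}. \<exists>j\<in>{1..4}. c 1 i * c 2 j \<noteq> c 1 j * c 2 i"
    by (intro bexI[of _ 1] bexI[of _ 2]) auto
  ultimately have "generic_coeffs c"
    by (simp add: generic_coeffs_def) (simp add: c_def)
  moreover have "constraint1_v1 c" "constraint2 c"
    by (simp_all add: constraint1_v1_def constraint2_def c_def)
  ultimately show ?thesis by blast
qed

end

theory Submission
  imports Defs "HOL-Complex_Analysis.Conformal_Mappings"
begin

text \<open>
  The parametrization says exactly that two linear forms obey closed equations along the flow:
  \<open>y = a1 x1 + a2 x2\<close> satisfies \<open>y' = y^3\<close>, and \<open>w = b1 x1 + b2 x2\<close> satisfies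
  \<open>w' = w^3 + \<gamma>1 w^2 y + \<gamma>2 w y^2 + \<gamma>3 y^3\<close> (lemma \<open>parametrized_iff\<close>).

  A form \<open>y\<close> with \<open>y' = y^3\<close> exists when the ratios of consecutive coefficients of
  \<open>a1 X1 + a2 X2\<close> are those of \<open>(x1 + p x2)^3\<close> with \<open>p = a2 / a1\<close>. This makes \<open>p\<close> a common root of
    \<open>3 c21 p^2 + (3 c11 - c22) p - c12\<close>,  \<open>c22 p^2 + (c12 - c23) p - c13\<close>,
    \<open>c23 p^2 + (c13 - 3 c24) p - 3 c14\<close>.
  The second constraint is the vanishing of the resultant of the first and the third quadratic,
  and each version of the first constraint is the vanishing of the determinant of all three,
  times one of the leading coefficients up to a constant. Hence a parametrized system satisfies all of them
  (lemma \<open>cubing_form_constraints\<close>). Conversely, the resultant and \<open>c12 c23 - 9 c14 c21 \<noteq> 0\<close> give a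
  nonzero common root of two independent quadratics, and the determinant makes the remaining
  quadratic a combination of these two (lemma \<open>common_root\<close>).

  Once \<open>y\<close> is known, any independent form \<open>w\<close> has some cubic \<open>w'\<close>; scaling \<open>w\<close> makes its \<open>w^3\<close>
  coefficient equal to 1 as soon as that coefficient is nonzero. If it vanished, the line \<open>y = 0\<close>
  would be a double root of the form \<open>x1 X2 - x2 X1\<close> whose roots are the invariant lines. The same
  form is, up to a constant, \<open>y\<close> times the product of the \<open>w - u_j y\<close>, so its squarefreeness also
  makes the \<open>u_j\<close> distinct.

  Finally, \<open>u = w / y\<close> satisfies \<open>u' = y^2 (u - u_1)(u - u_2)(u - u_3)\<close>. By partial fractions the
  logarithm of the implicit relation has derivative \<open>-2 / ((u - u_1)(u - u_2)(u - u_3))\<close> in \<open>u\<close>. As this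
  is finite and nonzero away from the \<open>u_j\<close>, the relation can be solved near \<open>t = 0\<close>
  (lemma \<open>implicit_relation_solvable\<close>), and every continuous solution of it, on whatever set of
  times, is differentiable and satisfies the differential equation for \<open>u\<close>
  (lemma \<open>implicit_relation_derivative\<close>).
\<close>

section \<open>The constraints as conditions for a common root\<close>

text \<open>
  The 3x3 determinant of the coefficients of the three quadratics in \<open>p\<close> displayed above,
  expanded along the row of \<open>c22 p^2 + (c12 - c23) p - c13\<close>. The cofactors are the minors of the two
  other rows that also enter the resultant \<open>constraint2\<close>.
\<close>

definition common_root_det :: "(nat \<Rightarrow> nat \<Rightarrow> complex) \<Rightarrow> complex" where
  "common_root_det c =
     c 2 2 * (c 1 2 * (c 1 3 - 3 * c 2 4) + 3 * c 1 4 * (- 3 * c 1 1 + c 2 2))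
     - (c 1 2 - c 2 3) * (c 1 2 * c 2 3 - 9 * c 1 4 * c 2 1)
     - c 1 3 * (3 * c 2 1 * (c 1 3 - 3 * c 2 4) + c 2 3 * (c 2 2 - 3 * c 1 1))"

lemma constraint1_v1_iff: "constraint1_v1 c \<longleftrightarrow> c 2 2 * common_root_det c = 0"
proof -
  have "(c 1 2 * c 2 2 - 3 * c 1 3 * c 2 1)
       * (c 1 2 * c 2 3 - c 1 3 * c 2 2 - (c 2 3)\<^sup>2 + 3 * c 2 2 * c 2 4)
     - (c 1 3 * c 2 3 - 3 * c 1 4 * c 2 2)
       * (3 * (c 1 1 * c 2 2 - c 1 2 * c 2 1 + c 2 1 * c 2 3) - (c 2 2)\<^sup>2)
     = - (c 2 2 * common_root_det c)"
    unfolding common_root_det_def by algebra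
  then show ?thesis
    unfolding constraint1_v1_def by (metis eq_iff_diff_eq_0 neg_equal_0_iff_equal)
qed

lemma constraint1_v2_iff: "constraint1_v2 c \<longleftrightarrow> c 2 3 * common_root_det c = 0"
proof -
  have "(c 1 3 * c 2 3 - 3 * c 1 4 * c 2 2)
       * (3 * (c 1 1 * c 2 3 - c 1 3 * c 2 1) + 9 * c 2 1 * c 2 4 - c 2 2 * c 2 3)
     - (c 1 2 * c 2 3 - 9 * c 1 4 * c 2 1)
       * (c 1 2 * c 2 3 - c 1 3 * c 2 2 - (c 2 3)\<^sup>2 + 3 * c 2 2 * c 2 4)
     = c 2 3 * common_root_det c"
    unfolding common_root_det_def by algebra
  then show ?thesis
    unfolding constraint1_v2_def by (metis eq_iff_diff_eq_0)
qed

lemma constraint1_v3_iff: "constraint1_v3 c \<longleftrightarrow> c 2 1 * common_root_det c = 0"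
proof -
  have "(c 1 2 * c 2 3 - 9 * c 1 4 * c 2 1)
       * (3 * (c 1 1 * c 2 2 - c 1 2 * c 2 1 + c 2 1 * c 2 3) - (c 2 2)\<^sup>2)
     - (c 1 2 * c 2 2 - 3 * c 1 3 * c 2 1)
       * (3 * (c 1 1 * c 2 3 - c 1 3 * c 2 1) + 9 * c 2 1 * c 2 4 - c 2 2 * c 2 3)
     = 3 * (c 2 1 * common_root_det c)"
    unfolding common_root_det_def by algebra
  moreover have "3 * (c 2 1 * common_root_det c) = 0 \<longleftrightarrow> c 2 1 * common_root_det c = 0"
    by simp
  ultimately show ?thesis
    unfolding constraint1_v3_def by (metis eq_iff_diff_eq_0)
qed

text \<open>
  Comparison of coefficients in \<open>a1 X1 + a2 X2 = (a1 x1 + a2 x2)^3\<close>: the linear form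
  \<open>y = a1 x1 + a2 x2\<close> satisfies \<open>y' = y^3\<close>.
\<close>

definition cubing_form :: "(nat \<Rightarrow> nat \<Rightarrow> complex) \<Rightarrow> complex \<Rightarrow> complex \<Rightarrow> bool" where
  "cubing_form c a1 a2 \<longleftrightarrow>
     a1 * c 1 1 + a2 * c 2 1 = a1 ^ 3 \<and>
     a1 * c 1 2 + a2 * c 2 2 = 3 * a1\<^sup>2 * a2 \<and>
     a1 * c 1 3 + a2 * c 2 3 = 3 * a1 * a2\<^sup>2 \<and>
     a1 * c 1 4 + a2 * c 2 4 = a2 ^ 3"

lemma cramer_2x2:
  fixes a1 a2 b1 b2 e k x z :: complex
  assumes "a1 * b2 - a2 * b1 \<noteq> 0"
  shows "x = (e * b2 - a2 * k) / (a1 * b2 - a2 * b1) \<and> z = (- e * b1 + a1 * k) / (a1 * b2 - a2 * b1)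
         \<longleftrightarrow> a1 * x + a2 * z = e \<and> b1 * x + b2 * z = k"
  (is "?L \<longleftrightarrow> ?R")
proof -
  have "?L \<longleftrightarrow> x * (a1 * b2 - a2 * b1) = e * b2 - a2 * k \<and> z * (a1 * b2 - a2 * b1) = - e * b1 + a1 * k"
    unfolding nonzero_eq_divide_eq[OF assms] by (rule refl)
  also have "\<dots> \<longleftrightarrow> ?R"
  proof safe
    assume *: "x * (a1 * b2 - a2 * b1) = e * b2 - a2 * k" "z * (a1 * b2 - a2 * b1) = - e * b1 + a1 * k"
    have "(a1 * b2 - a2 * b1) * (a1 * x + a2 * z) = (a1 * b2 - a2 * b1) * e"
      using * by algebra
    then show "a1 * x + a2 * z = e" using assms by simp
    have "(a1 * b2 - a2 * b1) * (b1 * x + b2 * z) = (a1 * b2 - a2 * b1) * k"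
      using * by algebra
    then show "b1 * x + b2 * z = k" using assms by simp
  qed (simp_all add: algebra_simps)
  finally show ?thesis .
qed

text \<open>
  The parametrization is Cramer's rule applied, for each monomial, to the coefficients of
  \<open>y' = y^3\<close> and of \<open>w' = w^3 + \<gamma>1 w^2 y + \<gamma>2 w y^2 + \<gamma>3 y^3\<close>; the numbers \<open>K1\<close>, ..., \<open>K4\<close> are the
  coefficients of the latter in terms of \<open>x1, x2\<close>.
\<close>

lemma parametrized_iff:
  assumes "a1 * b2 - a2 * b1 \<noteq> 0"
  shows "parametrized c a1 a2 b1 b2 \<gamma>1 \<gamma>2 \<gamma>3 \<longleftrightarrow>
     cubing_form c a1 a2 \<and>
     b1 * c 1 1 + b2 * c 2 1 = K1 a1 a2 b1 b2 \<gamma>1 \<gamma>2 \<gamma>3 \<and>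
     b1 * c 1 2 + b2 * c 2 2 = K2 a1 a2 b1 b2 \<gamma>1 \<gamma>2 \<gamma>3 \<and>
     b1 * c 1 3 + b2 * c 2 3 = K3 a1 a2 b1 b2 \<gamma>1 \<gamma>2 \<gamma>3 \<and>
     b1 * c 1 4 + b2 * c 2 4 = K4 a1 a2 b1 b2 \<gamma>1 \<gamma>2 \<gamma>3"
  using cramer_2x2[OF assms, of "c 1 1" "a1 ^ 3" _ "c 2 1"]
    cramer_2x2[OF assms, of "c 1 2" "3 * a1\<^sup>2 * a2" _ "c 2 2"]
    cramer_2x2[OF assms, of "c 1 3" "3 * a1 * a2\<^sup>2" _ "c 2 3"]
    cramer_2x2[OF assms, of "c 1 4" "a2 ^ 3" _ "c 2 4"]
  unfolding parametrized_def Let_def cubing_form_def mult_minus_left by blast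

text \<open>
  The vector \<open>(a2^2, a1 a2, a1^2)\<close> is annihilated by the three rows of the determinant, and is
  therefore proportional to the vector of minors of the first and the third row. So in that
  vector of minors, too, the square of the middle entry is the product of the outer entries.
\<close>

lemma cubing_form_constraints:
  assumes "cubing_form c a1 a2" and "a1 \<noteq> 0" and "a2 \<noteq> 0"
  shows "common_root_det c = 0" and "constraint2 c"
proof -
  have q1: "3 * c 2 1 * a2\<^sup>2 + (3 * c 1 1 - c 2 2) * a1 * a2 - c 1 2 * a1\<^sup>2 = 0"
    and q2: "c 2 2 * a2\<^sup>2 + (c 1 2 - c 2 3) * a1 * a2 - c 1 3 * a1\<^sup>2 = 0"
    and q3: "c 2 3 * a2\<^sup>2 + (c 1 3 - 3 * c 2 4) * a1 * a2 - 3 * c 1 4 * a1\<^sup>2 = 0"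
    using assms(1) unfolding cubing_form_def by algebra+
  have "a1\<^sup>2 * common_root_det c = 0"
    unfolding common_root_det_def using q1 q2 q3 by algebra
  then show "common_root_det c = 0"
    using assms(2) by simp
  define m23 where "m23 = c 1 2 * (c 1 3 - 3 * c 2 4) + 3 * c 1 4 * (- 3 * c 1 1 + c 2 2)"
  define m12 where "m12 = 3 * c 2 1 * (c 1 3 - 3 * c 2 4) + c 2 3 * (c 2 2 - 3 * c 1 1)"
  define m13 where "m13 = c 1 2 * c 2 3 - 9 * c 1 4 * c 2 1"
  have "a1 * (m12 * a2 + m13 * a1) = 0"
    unfolding m12_def m13_def using q1 q3 by algebra
  moreover have "a2 * (m23 * a1 + m13 * a2) = 0"
    unfolding m23_def m13_def using q1 q3 by algebra
  ultimately have "m12 * a2 + m13 * a1 = 0" "m23 * a1 + m13 * a2 = 0"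
    using assms(2,3) by simp_all
  then have "a1 * a2 * (m23 * m12 - m13\<^sup>2) = 0"
    by algebra
  then have "m23 * m12 = m13\<^sup>2"
    using assms(2,3) by simp
  then show "constraint2 c"
    unfolding constraint2_def m23_def m12_def m13_def .
qed

text \<open>
  With \<open>m13 \<noteq> 0\<close> the vector \<open>(m23, -m13, m12)\<close> of minors of the first and third quadratic spans the
  solutions of these two rows, and the resultant says that it has the form \<open>m12 (p^2, p, 1)\<close>. The
  determinant is the value of the second row on it.
\<close>

lemma common_root:
  assumes "common_root_det c = 0" "constraint2 c"
    and M: "c 1 2 * c 2 3 - 9 * c 1 4 * c 2 1 \<noteq> 0"
  obtains p where "p \<noteq> 0"
    "3 * c 2 1 * p\<^sup>2 + (3 * c 1 1 - c 2 2) * p - c 1 2 = 0"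
    "c 2 2 * p\<^sup>2 + (c 1 2 - c 2 3) * p - c 1 3 = 0"
    "c 2 3 * p\<^sup>2 + (c 1 3 - 3 * c 2 4) * p - 3 * c 1 4 = 0"
proof -
  define m23 where "m23 = c 1 2 * (c 1 3 - 3 * c 2 4) + 3 * c 1 4 * (- 3 * c 1 1 + c 2 2)"
  define m12 where "m12 = 3 * c 2 1 * (c 1 3 - 3 * c 2 4) + c 2 3 * (c 2 2 - 3 * c 1 1)"
  define m13 where "m13 = c 1 2 * c 2 3 - 9 * c 1 4 * c 2 1"
  have res: "m23 * m12 = m13\<^sup>2"
    using assms(2) unfolding constraint2_def m23_def m12_def m13_def .
  then have nz: "m12 \<noteq> 0" "m13 \<noteq> 0"
    using M by (auto simp: m13_def)
  have det: "c 2 2 * m23 - (c 1 2 - c 2 3) * m13 - c 1 3 * m12 = 0"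
    using assms(1) unfolding common_root_det_def m23_def m12_def m13_def .
  define p where "p = - m13 / m12"
  have p1: "m12 * p = - m13"
    using nz by (simp add: p_def)
  have "m12 * (m12 * p\<^sup>2) = m12 * m23"
    using p1 res by algebra
  then have p2: "m12 * p\<^sup>2 = m23"
    using nz by simp
  show thesis
  proof
    show "p \<noteq> 0" using nz by (simp add: p_def)
    have "m12 * (3 * c 2 1 * p\<^sup>2 + (3 * c 1 1 - c 2 2) * p - c 1 2)
       = 3 * c 2 1 * m23 - (3 * c 1 1 - c 2 2) * m13 - c 1 2 * m12"
      using p1 p2 by algebra
    also have "\<dots> = 0" unfolding m23_def m12_def m13_def by algebra
    finally show "3 * c 2 1 * p\<^sup>2 + (3 * c 1 1 - c 2 2) * p - c 1 2 = 0"
      using nz by simp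
    have "m12 * (c 2 2 * p\<^sup>2 + (c 1 2 - c 2 3) * p - c 1 3) = 0"
      using p1 p2 det by algebra
    then show "c 2 2 * p\<^sup>2 + (c 1 2 - c 2 3) * p - c 1 3 = 0"
      using nz by simp
    have "m12 * (c 2 3 * p\<^sup>2 + (c 1 3 - 3 * c 2 4) * p - 3 * c 1 4)
       = c 2 3 * m23 - (c 1 3 - 3 * c 2 4) * m13 - 3 * c 1 4 * m12"
      using p1 p2 by algebra
    also have "\<dots> = 0" unfolding m23_def m12_def m13_def by algebra
    finally show "c 2 3 * p\<^sup>2 + (c 1 3 - 3 * c 2 4) * p - 3 * c 1 4 = 0"
      using nz by simp
  qed
qed

text \<open>
  At a common root \<open>p\<close> the form \<open>X1 + p X2\<close> equals \<open>A (x1 + p x2)^3\<close>. Here \<open>A \<noteq> 0\<close>, since otherwise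
  \<open>X1\<close> and \<open>X2\<close> would be proportional, so that \<open>a1\<close> can be taken as a square root of \<open>A\<close>.
\<close>

lemma obtain_cube_form:
  assumes "generic_coeffs c" "common_root_det c = 0" "constraint2 c"
  obtains a1 a2 where "a1 \<noteq> 0" "a2 \<noteq> 0" "cubing_form c a1 a2"
proof -
  from assms(1) have M: "c 1 2 * c 2 3 - 9 * c 1 4 * c 2 1 \<noteq> 0"
    unfolding generic_coeffs_def by blast
  obtain p where p: "p \<noteq> 0"
    and q: "3 * c 2 1 * p\<^sup>2 + (3 * c 1 1 - c 2 2) * p - c 1 2 = 0"
    "c 2 2 * p\<^sup>2 + (c 1 2 - c 2 3) * p - c 1 3 = 0"
    "c 2 3 * p\<^sup>2 + (c 1 3 - 3 * c 2 4) * p - 3 * c 1 4 = 0"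
    using common_root[OF assms(2,3) M] by blast
  define A where "A = c 1 1 + p * c 2 1"
  have c11: "c 1 1 = A - p * c 2 1"
    unfolding A_def by simp
  have c12: "c 1 2 = 3 * A * p - p * c 2 2"
    using q(1) c11 by algebra
  have c13: "c 1 3 = 3 * A * p\<^sup>2 - p * c 2 3"
    using q(2) c12 by algebra
  note c1 = c11 c12 c13
  have "3 * c 1 4 = 3 * (A * p ^ 3 - p * c 2 4)"
    using q c1 by algebra
  then have c14: "c 1 4 = A * p ^ 3 - p * c 2 4"
    by (rule iffD1[OF mult_left_cancel, rotated]) simp
  have "A \<noteq> 0"
  proof
    assume "A = 0"
    then have "c 1 l = - p * c 2 l" if "l \<in> {1..4}" for l
    proof -
      from that have "l = 1 \<or> l = 2 \<or> l = 3 \<or> l = 4" by auto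
      then show ?thesis using c1 c14 \<open>A = 0\<close> by auto
    qed
    then have "\<forall>i\<in>{1..4}. \<forall>j\<in>{1..4}. c 1 i * c 2 j = c 1 j * c 2 i" by simp
    then show False using assms(1) unfolding generic_coeffs_def by blast
  qed
  define a1 where "a1 = csqrt A"
  have a: "a1\<^sup>2 = A" "a1 \<noteq> 0" using \<open>A \<noteq> 0\<close> by (simp_all add: a1_def)
  have "cubing_form c a1 (p * a1)"
    unfolding cubing_form_def c1 c14 a(1)[symmetric] by algebra
  with a p show thesis using that[of a1 "p * a1"] by simp
qed

section \<open>Construction of the parameters\<close>

lemma rsquarefree_no_square_factor:
  fixes p :: "complex poly"
  assumes "rsquarefree p" and "p * k = [:f, e:] * [:f, e:] * r" and "poly k (- f / e) \<noteq> 0"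
  shows "e = 0"
proof (rule ccontr)
  assume e: "e \<noteq> 0"
  let ?s = "- f / e"
  have root: "poly [:f, e:] ?s = 0" using e by simp
  then have "poly (p * k) ?s = 0" "poly (pderiv (p * k)) ?s = 0"
    unfolding assms(2) by (simp_all only: pderiv_mult poly_mult poly_add) simp_all
  then have "poly p ?s = 0" "poly (pderiv p) ?s = 0"
    using assms(3) by (auto simp: pderiv_mult)
  then show False using assms(1) unfolding rsquarefree_roots by blast
qed

text \<open>
  The expression is \<open>X2\<close> at the point \<open>(-a2, a1)\<close> of the line \<open>y = 0\<close>, where \<open>X\<close> is parallel to that
  point; it is thus, up to a nonzero factor, the coefficient of \<open>w^3\<close> in \<open>w'\<close> for every linear form
  \<open>w\<close> independent of \<open>y\<close>. From \<open>a1 (x1 X2 - x2 X1) = y (X2 - x2 y^2)\<close>, a zero there makes \<open>y\<close> a double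
  factor of the form of the invariant lines.
\<close>

lemma w_cubed_coeff_nonzero:
  assumes sf: "rsquarefree (invariant_lines_poly c)"
    and a: "a1 \<noteq> 0" and cube: "cubing_form c a1 a2"
  shows "c 2 4 * a1 ^ 3 - c 2 3 * a1\<^sup>2 * a2 + c 2 2 * a1 * a2\<^sup>2 - c 2 1 * a2 ^ 3 \<noteq> 0"
proof
  assume 0: "c 2 4 * a1 ^ 3 - c 2 3 * a1\<^sup>2 * a2 + c 2 2 * a1 * a2\<^sup>2 - c 2 1 * a2 ^ 3 = 0"
  define Y where "Y = [:a2, a1:]"
  define X where "X = [:c 2 4, c 2 3, c 2 2, c 2 1:]"
  define s where "s = - a2 / a1"
  have factor: "invariant_lines_poly c * [:a1:] = Y * (X - Y * Y)"
    using cube unfolding invariant_lines_poly_def Y_def X_def cubing_form_def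
    by (simp add: algebra_simps power2_eq_square power3_eq_cube)
  have as: "a1 * s = - a2" using a by (simp add: s_def)
  have "a1 ^ 3 * poly X s = 0"
    unfolding X_def using as 0 by (simp add: algebra_simps) algebra
  then have "poly X s = 0" using a by simp
  then obtain T where "X = [:- s, 1:] * T"
    unfolding poly_eq_0_iff_dvd dvd_def by blast
  moreover have "[:- s, 1:] = smult (1 / a1) Y"
    using a by (simp add: Y_def s_def)
  ultimately have "invariant_lines_poly c * [:a1:] = Y * Y * (smult (1 / a1) T - Y)"
    unfolding factor by (simp add: algebra_simps)
  then have "a1 = 0"
    unfolding Y_def by (rule rsquarefree_no_square_factor[OF sf]) (simp add: a)
  then show False using a by simp
qed

text \<open>
  Every binary cubic in \<open>x1, x2\<close>, here with coefficients \<open>k1, ..., k4\<close>, can be rewritten as a cubic in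
  \<open>y, w\<close>. Only the normalization of the \<open>w^3\<close> coefficient, obtained from the value of the cubic at
  \<open>(x1, x2) = (-a2, a1)\<close>, where \<open>y = 0\<close> and \<open>w = d\<close>, is a condition.
\<close>

lemma cubic_form_pullback:
  fixes a1 a2 b1 b2 k1 k2 k3 k4 :: complex
  defines "d \<equiv> a1 * b2 - a2 * b1"
  assumes d: "d \<noteq> 0"
    and norm: "k4 * a1 ^ 3 - k3 * a1\<^sup>2 * a2 + k2 * a1 * a2\<^sup>2 - k1 * a2 ^ 3 = d ^ 3"
  obtains \<gamma>1 \<gamma>2 \<gamma>3 where
    "k1 = K1 a1 a2 b1 b2 \<gamma>1 \<gamma>2 \<gamma>3" "k2 = K2 a1 a2 b1 b2 \<gamma>1 \<gamma>2 \<gamma>3"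
    "k3 = K3 a1 a2 b1 b2 \<gamma>1 \<gamma>2 \<gamma>3" "k4 = K4 a1 a2 b1 b2 \<gamma>1 \<gamma>2 \<gamma>3"
proof -
  \<comment> \<open>the coefficients of the cubic after the substitution \<open>x1 = b2 y - a2 w\<close>, \<open>x2 = - b1 y + a1 w\<close>\<close>
  define G3 where "G3 = k1 * b2 ^ 3 - k2 * b2\<^sup>2 * b1 + k3 * b2 * b1\<^sup>2 - k4 * b1 ^ 3"
  define G2 where "G2 = - 3 * k1 * b2\<^sup>2 * a2 + k2 * (b2\<^sup>2 * a1 + 2 * b2 * a2 * b1)
    - k3 * (b1\<^sup>2 * a2 + 2 * b1 * a1 * b2) + 3 * k4 * b1\<^sup>2 * a1"
  define G1 where "G1 = 3 * k1 * b2 * a2\<^sup>2 - k2 * (a2\<^sup>2 * b1 + 2 * a2 * b2 * a1)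
    + k3 * (a1\<^sup>2 * b2 + 2 * a1 * a2 * b1) - 3 * k4 * b1 * a1\<^sup>2"
  define \<gamma>1 where "\<gamma>1 = G1 / d ^ 3"
  define \<gamma>2 where "\<gamma>2 = G2 / d ^ 3"
  define \<gamma>3 where "\<gamma>3 = G3 / d ^ 3"
  have g: "d ^ 3 * \<gamma>1 = G1" "d ^ 3 * \<gamma>2 = G2" "d ^ 3 * \<gamma>3 = G3"
    using d by (simp_all add: \<gamma>1_def \<gamma>2_def \<gamma>3_def)
  note G = G1_def G2_def G3_def
  have "d ^ 3 * K1 a1 a2 b1 b2 \<gamma>1 \<gamma>2 \<gamma>3 = G1 * a1 * b1\<^sup>2 + G2 * a1\<^sup>2 * b1 + G3 * a1 ^ 3 + d ^ 3 * b1 ^ 3"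
    unfolding K1_def g[symmetric] by (simp add: algebra_simps)
  also have "\<dots> = d ^ 3 * k1"
    unfolding norm[symmetric] G using norm[unfolded d_def] by algebra
  finally have 1: "k1 = K1 a1 a2 b1 b2 \<gamma>1 \<gamma>2 \<gamma>3" using d by simp
  have "d ^ 3 * K2 a1 a2 b1 b2 \<gamma>1 \<gamma>2 \<gamma>3 = G1 * (a2 * b1\<^sup>2 + 2 * a1 * b1 * b2)
     + G2 * (a1\<^sup>2 * b2 + 2 * a1 * a2 * b1) + 3 * G3 * a1\<^sup>2 * a2 + d ^ 3 * (3 * b1\<^sup>2 * b2)"
    unfolding K2_def g[symmetric] by (simp add: algebra_simps)
  also have "\<dots> = d ^ 3 * k2"
    unfolding norm[symmetric] G using norm[unfolded d_def] by algebra
  finally have 2: "k2 = K2 a1 a2 b1 b2 \<gamma>1 \<gamma>2 \<gamma>3" using d by simp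
  have "d ^ 3 * K3 a1 a2 b1 b2 \<gamma>1 \<gamma>2 \<gamma>3 = G1 * (a1 * b2\<^sup>2 + 2 * a2 * b1 * b2)
     + G2 * (a2\<^sup>2 * b1 + 2 * a1 * a2 * b2) + 3 * G3 * a1 * a2\<^sup>2 + d ^ 3 * (3 * b1 * b2\<^sup>2)"
    unfolding K3_def g[symmetric] by (simp add: algebra_simps)
  also have "\<dots> = d ^ 3 * k3"
    unfolding norm[symmetric] G using norm[unfolded d_def] by algebra
  finally have 3: "k3 = K3 a1 a2 b1 b2 \<gamma>1 \<gamma>2 \<gamma>3" using d by simp
  have "d ^ 3 * K4 a1 a2 b1 b2 \<gamma>1 \<gamma>2 \<gamma>3 = G1 * a2 * b2\<^sup>2 + G2 * a2\<^sup>2 * b2 + G3 * a2 ^ 3 + d ^ 3 * b2 ^ 3"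
    unfolding K4_def g[symmetric] by (simp add: algebra_simps)
  also have "\<dots> = d ^ 3 * k4"
    unfolding norm[symmetric] G using norm[unfolded d_def] by algebra
  finally have 4: "k4 = K4 a1 a2 b1 b2 \<gamma>1 \<gamma>2 \<gamma>3" using d by simp
  show thesis using that 1 2 3 4 by blast
qed

lemma obtain_parametrization:
  assumes gen: "generic_coeffs c" and "common_root_det c = 0" "constraint2 c"
  obtains a1 a2 b1 b2 \<gamma>1 \<gamma>2 \<gamma>3
  where "admissible_params a1 a2 b1 b2" "parametrized c a1 a2 b1 b2 \<gamma>1 \<gamma>2 \<gamma>3"
proof -
  obtain a1 a2 where a: "a1 \<noteq> 0" "a2 \<noteq> 0" and cube: "cubing_form c a1 a2"
    using obtain_cube_form[OF assms] by blast
  define N where "N = c 2 4 * a1 ^ 3 - c 2 3 * a1\<^sup>2 * a2 + c 2 2 * a1 * a2\<^sup>2 - c 2 1 * a2 ^ 3"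
  have "N \<noteq> 0"
    unfolding N_def using gen a(1) cube
    by (intro w_cubed_coeff_nonzero) (auto simp: generic_coeffs_def)
  \<comment> \<open>The vector field at \<open>(-a2, a1)\<close> is \<open>N / a1\<close> times that point, so the \<open>w^3\<close> coefficient is \<open>(N / a1) / d^2\<close>.\<close>
  define d where "d = csqrt (N / a1)"
  have d: "d \<noteq> 0" using \<open>N \<noteq> 0\<close> a by (simp add: d_def)
  have "d\<^sup>2 = N / a1" by (simp add: d_def)
  then have N: "N = a1 * d\<^sup>2" using a by simp
  \<comment> \<open>any nonzero \<open>b1, b2\<close> with \<open>a1 b2 - a2 b1 = d\<close>\<close>
  define b1 b2 where "b1 = d / a2" and "b2 = 2 * d / a1"
  have b: "b1 \<noteq> 0" "b2 \<noteq> 0" using a d by (simp_all add: b1_def b2_def)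
  have dd: "a1 * b2 - a2 * b1 = d" using a by (simp add: b1_def b2_def)
  have dd0: "a1 * b2 - a2 * b1 \<noteq> 0" using d dd by simp
  define k where "k = (\<lambda>l. b1 * c 1 l + b2 * c 2 l)"
  have "a1 * (k 4 * a1 ^ 3 - k 3 * a1\<^sup>2 * a2 + k 2 * a1 * a2\<^sup>2 - k 1 * a2 ^ 3)
      = (a1 * b2 - a2 * b1) * N"
    using cube unfolding cubing_form_def k_def N_def by algebra
  also have "\<dots> = a1 * d ^ 3"
    unfolding dd N by algebra
  finally have "k 4 * a1 ^ 3 - k 3 * a1\<^sup>2 * a2 + k 2 * a1 * a2\<^sup>2 - k 1 * a2 ^ 3 = d ^ 3"
    using a by simp
  then obtain \<gamma>1 \<gamma>2 \<gamma>3 where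
    "k 1 = K1 a1 a2 b1 b2 \<gamma>1 \<gamma>2 \<gamma>3" "k 2 = K2 a1 a2 b1 b2 \<gamma>1 \<gamma>2 \<gamma>3"
    "k 3 = K3 a1 a2 b1 b2 \<gamma>1 \<gamma>2 \<gamma>3" "k 4 = K4 a1 a2 b1 b2 \<gamma>1 \<gamma>2 \<gamma>3"
    using cubic_form_pullback[of a1 b2 a2 b1 "k 4" "k 3" "k 2" "k 1"] d dd by metis
  then have "parametrized c a1 a2 b1 b2 \<gamma>1 \<gamma>2 \<gamma>3"
    using cube unfolding parametrized_iff[OF dd0] k_def by blast
  moreover have "admissible_params a1 a2 b1 b2"
    using a b d dd by (simp add: admissible_params_def)
  ultimately show thesis using that by blast
qed

lemma cubic_roots_iff:
  "cubic_roots \<gamma>1 \<gamma>2 \<gamma>3 u \<longleftrightarrow>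
     \<gamma>1 = - (u 1 + u 2 + u 3) \<and> \<gamma>2 - 1 = u 1 * u 2 + u 1 * u 3 + u 2 * u 3 \<and>
     \<gamma>3 = - (u 1 * u 2 * u 3)"
proof -
  have "(\<Prod>j\<in>{1,2,3}. [: - u j, 1 :]) =
      [: - (u 1 * u 2 * u 3), u 1 * u 2 + u 1 * u 3 + u 2 * u 3, - (u 1 + u 2 + u 3), 1 :]"
    by (simp add: algebra_simps)
  then show ?thesis
    unfolding cubic_roots_def by auto
qed

lemma obtain_cubic_roots:
  obtains u where "cubic_roots \<gamma>1 \<gamma>2 \<gamma>3 u"
proof -
  let ?p = "[: \<gamma>3, \<gamma>2 - 1, \<gamma>1, 1 :]"
  obtain A where "size A = degree ?p" and A: "?p = smult (lead_coeff ?p) (\<Prod>x\<in>#A. [:-x, 1:])"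
    using alg_closed_imp_factorization[of ?p] by auto
  then have "size A = Suc (Suc (Suc 0))" by simp
  then obtain x y z where "A = {#x, y, z#}"
    by (metis size_eq_Suc_imp_eq_union size_add_mset nat.inject size_eq_0_iff_empty)
  with A have "cubic_roots \<gamma>1 \<gamma>2 \<gamma>3 (\<lambda>j. if j = 1 then x else if j = 2 then y else z)"
    unfolding cubic_roots_def by simp
  then show thesis by (rule that)
qed

text \<open>
  In terms of \<open>y\<close> and \<open>w\<close>, the form \<open>d (x1 X2 - x2 X1) = y w' - w y'\<close> is \<open>y\<close> times the homogenization
  of the cubic with roots \<open>u_j\<close>, that is \<open>y (w - u_1 y)(w - u_2 y)(w - u_3 y)\<close>. Since the invariant
  lines are distinct, so are the \<open>u_j\<close>. The hypothesis \<open>c21 \<noteq> 0\<close> keeps every factor linear after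
  dehomogenization.
\<close>

lemma cubic_roots_distinct:
  assumes gen: "generic_coeffs c" and adm: "admissible_params a1 a2 b1 b2"
    and par: "parametrized c a1 a2 b1 b2 \<gamma>1 \<gamma>2 \<gamma>3" and roots: "cubic_roots \<gamma>1 \<gamma>2 \<gamma>3 u"
  shows "inj_on u {1, 2, 3}"
proof -
  define d where "d = a1 * b2 - a2 * b1"
  have d: "d \<noteq> 0" and a1: "a1 \<noteq> 0" using adm by (auto simp: admissible_params_def d_def)
  have c21: "c 2 1 \<noteq> 0" and sf: "rsquarefree (invariant_lines_poly c)"
    using gen by (auto simp: generic_coeffs_def)
  \<comment> \<open>\<open>Y\<close> and \<open>F j\<close> are \<open>y\<close> and \<open>w - u_j y\<close> at \<open>(x1, x2) = (s, 1)\<close>, as polynomials in \<open>s\<close>.\<close>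
  define Y where "Y = [:a2, a1:]"
  define x z where "x = (\<lambda>j. b2 - u j * a2)" and "z = (\<lambda>j. b1 - u j * a1)"
  define F where "F = (\<lambda>j. [: x j, z j :])"
  have rel: "cubing_form c a1 a2"
     "b1 * c 1 1 + b2 * c 2 1 = K1 a1 a2 b1 b2 \<gamma>1 \<gamma>2 \<gamma>3"
     "b1 * c 1 2 + b2 * c 2 2 = K2 a1 a2 b1 b2 \<gamma>1 \<gamma>2 \<gamma>3"
     "b1 * c 1 3 + b2 * c 2 3 = K3 a1 a2 b1 b2 \<gamma>1 \<gamma>2 \<gamma>3"
     "b1 * c 1 4 + b2 * c 2 4 = K4 a1 a2 b1 b2 \<gamma>1 \<gamma>2 \<gamma>3"
    using par unfolding parametrized_iff[OF d[unfolded d_def]] by blast+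
  have \<gamma>: "\<gamma>1 = - (u 1 + u 2 + u 3)" "\<gamma>2 = 1 + (u 1 * u 2 + u 1 * u 3 + u 2 * u 3)"
     "\<gamma>3 = - (u 1 * u 2 * u 3)"
    using roots unfolding cubic_roots_iff by (auto simp: algebra_simps)
  have "d * - c 1 4 = a2 * x 1 * x 2 * x 3"
    and "d * (c 2 4 - c 1 3) = a1 * x 1 * x 2 * x 3
           + a2 * (z 1 * x 2 * x 3 + x 1 * z 2 * x 3 + x 1 * x 2 * z 3)"
    and "d * (c 2 3 - c 1 2) = a1 * (z 1 * x 2 * x 3 + x 1 * z 2 * x 3 + x 1 * x 2 * z 3)
           + a2 * (z 1 * z 2 * x 3 + z 1 * x 2 * z 3 + x 1 * z 2 * z 3)"
    and "d * (c 2 2 - c 1 1) = a1 * (z 1 * z 2 * x 3 + z 1 * x 2 * z 3 + x 1 * z 2 * z 3)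
           + a2 * z 1 * z 2 * z 3"
    and lead: "d * c 2 1 = a1 * z 1 * z 2 * z 3"
    using rel unfolding cubing_form_def K1_def K2_def K3_def K4_def \<gamma> d_def x_def z_def
    by algebra+
  then have factor: "invariant_lines_poly c * [:d:] = Y * (F 1 * F 2 * F 3)"
    unfolding invariant_lines_poly_def Y_def F_def by (simp add: algebra_simps)
  have distinct: "u i \<noteq> u j" if ij: "invariant_lines_poly c * [:d:] = F i * F j * R"
    and nz: "z i \<noteq> 0" for i j R
  proof
    assume "u i = u j"
    then have "F j = F i" by (simp add: F_def x_def z_def)
    with ij have "invariant_lines_poly c * [:d:]
      = [: x i, z i :] * [: x i, z i :] * R"
      by (simp add: F_def)
    then have "z i = 0"
      by (rule rsquarefree_no_square_factor[OF sf]) (simp add: d)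
    with nz show False by blast
  qed
  have nz: "z 1 \<noteq> 0" "z 2 \<noteq> 0"
    using lead d c21 by auto
  have "invariant_lines_poly c * [:d:] = F 1 * F 2 * (Y * F 3)"
    "invariant_lines_poly c * [:d:] = F 1 * F 3 * (Y * F 2)"
    "invariant_lines_poly c * [:d:] = F 2 * F 3 * (Y * F 1)"
    unfolding factor by (simp_all only: mult_ac)
  then have "u 1 \<noteq> u 2" "u 1 \<noteq> u 3" "u 2 \<noteq> u 3"
    using distinct nz by blast+
  then show ?thesis by (auto simp: inj_on_def)
qed

section \<open>The implicit relation\<close>

text \<open>
  The set \<open>S\<close> is arbitrary (a time set may well have empty interior), so this is argued with
  difference quotients and not with a local inverse of \<open>H\<close> on an open set of times: writing
  \<open>H v - H (u t0) = h v (v - u t0)\<close> with \<open>h\<close> continuous at \<open>u t0\<close>, one divides by \<open>h (u t)\<close>.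
\<close>

lemma has_field_derivative_implicit:
  fixes H :: "complex \<Rightarrow> complex"
  assumes H: "(H has_field_derivative D) (at (u t0))" and D: "D \<noteq> 0"
    and u: "continuous (at t0 within S) u"
    and g: "(g has_field_derivative E) (at t0 within S)"
    and eq: "\<forall>\<^sub>F t in at t0 within S. H (u t) = g t" and eq0: "H (u t0) = g t0"
  shows "(u has_field_derivative E / D) (at t0 within S)"
proof -
  obtain h where h: "\<And>v. H v - H (u t0) = h v * (v - u t0)"
    and hc: "continuous (at (u t0)) h" and h0: "h (u t0) = D"
    using H unfolding DERIV_caratheodory_within by blast
  have "((\<lambda>t. h (u t)) \<longlongrightarrow> h (u t0)) (at t0 within S)"
    using u hc unfolding continuous_within
    by (metis continuous_within isCont_tendsto_compose hc)
  then have hlim: "((\<lambda>t. h (u t)) \<longlongrightarrow> D) (at t0 within S)"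
    unfolding h0 .
  then have nz: "\<forall>\<^sub>F t in at t0 within S. h (u t) \<noteq> 0"
    using D by (rule tendsto_imp_eventually_ne)
  have "((\<lambda>t. (g t - g t0) / (t - t0) / h (u t)) \<longlongrightarrow> E / D) (at t0 within S)"
    using g hlim D unfolding has_field_derivative_iff by (intro tendsto_divide) auto
  moreover have "\<forall>\<^sub>F t in at t0 within S.
      (g t - g t0) / (t - t0) / h (u t) = (u t - u t0) / (t - t0)"
    using eq nz
  proof eventually_elim
    case (elim t)
    then have "g t - g t0 = h (u t) * (u t - u t0)"
      using h[of "u t"] eq0 by simp
    then show ?case using elim(2) by simp
  qed
  ultimately show ?thesis
    unfolding has_field_derivative_iff by (simp cong: tendsto_cong)
qed

text \<open>
  A continuous logarithm cannot jump by a multiple of \<open>2 pi i\<close>, hence agrees near each point with a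
  shifted principal branch. This turns the branches in \<open>power_branch\<close> into analytic functions of \<open>u\<close>.
\<close>

lemma continuous_log_local:
  assumes L: "continuous_on S L" and t0: "t0 \<in> S"
  shows "\<forall>\<^sub>F t in at t0 within S. L t = L t0 + Ln (exp (L t) / exp (L t0))"
proof -
  have "(L \<longlongrightarrow> L t0) (at t0 within S)"
    using L t0 by (simp add: continuous_on_def)
  then have "\<forall>\<^sub>F t in at t0 within S. dist (L t) (L t0) < 1"
    by (rule tendstoD) simp
  then show ?thesis
  proof eventually_elim
    case (elim t)
    have "\<bar>Im (L t - L t0)\<bar> < 1"
      using abs_Im_le_cmod[of "L t - L t0"] elim by (simp add: dist_norm)
    then have "Ln (exp (L t - L t0)) = L t - L t0"
      using pi_gt3 by (intro Ln_exp) auto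
    then show ?case by (simp add: exp_diff)
  qed
qed

lemma lam_partial_fractions:
  assumes inj: "inj_on u {1, 2, 3}" and v: "\<forall>j\<in>{1,2,3}. v \<noteq> u j"
  shows "(\<Sum>j\<in>{1,2,3}. lam u j / (v - u j)) = 1 / (\<Prod>j\<in>{1,2,3}. v - u j)"
proof -
  have d: "u 1 \<noteq> u 2" "u 1 \<noteq> u 3" "u 2 \<noteq> u 3"
    using inj by (auto simp: inj_on_def)
  have nz: "u 1 - u 2 \<noteq> 0" "u 1 - u 3 \<noteq> 0" "u 2 - u 3 \<noteq> 0" "u 2 - u 1 \<noteq> 0" "u 3 - u 1 \<noteq> 0"
      "u 3 - u 2 \<noteq> 0"
     "v - u 1 \<noteq> 0" "v - u 2 \<noteq> 0" "v - u 3 \<noteq> 0"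
    using d v by auto
  have s: "{1,2,3} - {1} = {2,3::nat}" "{1,2,3} - {2} = {1,3::nat}" "{1,2,3} - {3} = {1,2::nat}"
    by auto
  define p q r where "p = u 1" and "q = u 2" and "r = u 3"
  have l: "lam u 1 = 1 / ((p - q) * (p - r))" "lam u 2 = 1 / ((q - p) * (q - r))"
    "lam u 3 = 1 / ((r - p) * (r - q))"
    unfolding lam_def s p_def q_def r_def by (simp_all add: divide_inverse)
  have common: "1 / (A * B) / x + 1 / (- A * C) / y + 1 / (- B * - C) / z
      = (C * y * z - B * x * z + A * x * y) / (A * B * C * (x * y * z))"
    if "A \<noteq> 0" "B \<noteq> 0" "C \<noteq> 0" "x \<noteq> 0" "y \<noteq> 0" "z \<noteq> 0" for A B C x y z :: complex
    using that by (simp add: field_simps)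
  have "1 / ((p - q) * (p - r)) / (v - p) + 1 / ((q - p) * (q - r)) / (v - q)
     + 1 / ((r - p) * (r - q)) / (v - r)
     = ((q - r) * (v - q) * (v - r) - (p - r) * (v - p) * (v - r) + (p - q) * (v - p) * (v - q))
       / ((p - q) * (p - r) * (q - r) * ((v - p) * (v - q) * (v - r)))"
    using common[of "p - q" "p - r" "q - r" "v - p" "v - q" "v - r"] nz
    unfolding p_def[symmetric] q_def[symmetric] r_def[symmetric] minus_diff_eq by simp
  also have "(q - r) * (v - q) * (v - r) - (p - r) * (v - p) * (v - r) + (p - q) * (v - p) * (v - q)
     = (p - q) * (p - r) * (q - r)"
    by algebra
  also have "(p - q) * (p - r) * (q - r) / ((p - q) * (p - r) * (q - r) * ((v - p) * (v - q) * (v - r)))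
      = 1 / ((v - p) * (v - q) * (v - r))"
    using nz unfolding p_def[symmetric] q_def[symmetric] r_def[symmetric] by simp
  finally have "1 / ((p - q) * (p - r)) / (v - p) + 1 / ((q - p) * (q - r)) / (v - q)
     + 1 / ((r - p) * (r - q)) / (v - r) = 1 / ((v - p) * (v - q) * (v - r))" .
  then show ?thesis
    using l by (simp add: p_def q_def r_def algebra_simps del: One_nat_def)
qed

lemma sum_log_has_derivative:
  assumes inj: "inj_on u {1, 2, 3}" and v: "\<forall>j\<in>{1,2,3}. v0 \<noteq> u j"
    and z: "\<forall>j\<in>{1,2,3}. (v - u j) / (v0 - u j) \<notin> \<real>\<^sub>\<le>\<^sub>0"
  shows "((\<lambda>v. \<Sum>j\<in>{1,2,3}. lam u j * Ln ((v - u j) / (v0 - u j)))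
          has_field_derivative 1 / (\<Prod>j\<in>{1,2,3}. v - u j)) (at v)"
proof -
  have ne: "\<forall>j\<in>{1,2,3}. v \<noteq> u j" using z by force
  have "((\<lambda>v. \<Sum>j\<in>{1,2,3}. lam u j * Ln ((v - u j) / (v0 - u j)))
          has_field_derivative (\<Sum>j\<in>{1,2,3}. lam u j / (v - u j))) (at v)"
  proof (rule DERIV_sum)
    fix j :: nat assume j: "j \<in> {1,2,3}"
    then have "v0 - u j \<noteq> 0" "v - u j \<noteq> 0" "(v - u j) / (v0 - u j) \<notin> \<real>\<^sub>\<le>\<^sub>0"
      using v z ne by auto
    then show "((\<lambda>v. lam u j * Ln ((v - u j) / (v0 - u j))) has_field_derivative lam u j / (v - u j)) (at v)"
      by (auto intro!: derivative_eq_intros)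
  qed
  then show ?thesis unfolding lam_partial_fractions[OF inj ne] .
qed

text \<open>
  Dividing the relation at \<open>t\<close> by the relation at \<open>t0\<close> gives
  \<open>exp (-2 G (u t)) = (1 - \<kappa> t) / (1 - \<kappa> t0)\<close> for \<open>t\<close> near \<open>t0\<close>, where \<open>G\<close> is the sum of principal
  logarithms normalized at \<open>u t0\<close>, with derivative \<open>1 / ((v - r 1)(v - r 2)(v - r 3))\<close>.
\<close>

lemma implicit_relation_derivative:
  assumes inj: "inj_on r {1, 2, 3}"
    and init: "\<forall>j\<in>{1,2,3}. v0 \<noteq> r j"
    and L: "\<forall>j\<in>{1,2,3}. continuous_on S (L j)"
    and expL: "\<forall>j\<in>{1,2,3}. \<forall>t\<in>S. exp (L j t) = (u t - r j) / (v0 - r j)"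
    and rel: "\<forall>t\<in>S. (\<Prod>j\<in>{1,2,3}. exp (- 2 * lam r j * L j t)) = 1 - \<kappa> * t"
    and t0: "t0 \<in> S"
  shows "(u has_field_derivative \<kappa> / 2 * (\<Prod>j\<in>{1,2,3}. u t0 - r j) / (1 - \<kappa> * t0)) (at t0 within S)"
proof -
  have nz: "1 - \<kappa> * t0 \<noteq> 0"
    using rel t0 by (metis (no_types, lifting) exp_not_eq_zero finite.emptyI finite.insertI prod_zero_iff)
  have ne: "\<forall>j\<in>{1,2,3}. u t \<noteq> r j" if "t \<in> S" for t
    using expL that by (metis diff_self div_0 exp_not_eq_zero)
  have "continuous_on S (\<lambda>t. r 1 + (v0 - r 1) * exp (L 1 t))"
    using L by (intro continuous_intros) simp
  moreover have "r 1 + (v0 - r 1) * exp (L 1 t) = u t" if "t \<in> S" for t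
    using expL init that by simp
  ultimately have "continuous_on S u" by (simp cong: continuous_on_cong)
  then have u: "continuous (at t0 within S) u"
    using t0 by (simp add: continuous_on_eq_continuous_within)
  define P where "P = (\<Prod>j\<in>{1,2,3}. u t0 - r j)"
  have P: "P \<noteq> 0" using ne[OF t0] by (simp add: P_def)
  define G where "G = (\<lambda>v. \<Sum>j\<in>{1,2,3}. lam r j * Ln ((v - r j) / (u t0 - r j)))"
  have G0: "G (u t0) = 0" using ne[OF t0] by (simp add: G_def)
  have "(G has_field_derivative 1 / P) (at (u t0))"
    unfolding G_def P_def using ne[OF t0]
    by (intro sum_log_has_derivative[OF inj]) auto
  then have "((\<lambda>v. exp (- 2 * G v)) has_field_derivative - 2 / P) (at (u t0))"
    by (auto intro!: derivative_eq_intros simp: G0)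
  moreover have "- 2 / P \<noteq> 0" using P by simp
  moreover have "((\<lambda>t. (1 - \<kappa> * t) / (1 - \<kappa> * t0)) has_field_derivative - \<kappa> / (1 - \<kappa> * t0)) (at t0 within S)"
    using nz by (auto intro!: derivative_eq_intros)
  moreover have "\<forall>\<^sub>F t in at t0 within S. exp (- 2 * G (u t)) = (1 - \<kappa> * t) / (1 - \<kappa> * t0)"
  proof -
    have "\<forall>\<^sub>F t in at t0 within S. \<forall>j\<in>{1,2,3}. L j t = L j t0 + Ln (exp (L j t) / exp (L j t0))"
      using L t0 by (intro eventually_ball_finite) (auto intro: continuous_log_local)
    moreover have "\<forall>\<^sub>F t in at t0 within S. t \<in> S"
      by (simp add: eventually_at_filter)
    ultimately show ?thesis
    proof eventually_elim
      case (elim t)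
      have "Ln ((u t - r j) / (u t0 - r j)) = L j t - L j t0" if j: "j \<in> {1,2,3}" for j
      proof -
        have "(u t - r j) / (u t0 - r j) = exp (L j t) / exp (L j t0)"
        proof -
          have e: "exp (L j t) = (u t - r j) / (v0 - r j)" "exp (L j t0) = (u t0 - r j) / (v0 - r j)"
            using expL j elim(2) t0 by blast+
          have "v0 - r j \<noteq> 0" using init j by force
          then show ?thesis unfolding e by simp
        qed
        then show ?thesis using elim(1) j by (metis add_diff_cancel_left')
      qed
      then have Gu: "G (u t) = (\<Sum>j\<in>{1,2,3}. lam r j * (L j t - L j t0))"
        unfolding G_def by (intro sum.cong) simp_all
      have "- 2 * G (u t) = (\<Sum>j\<in>{1,2,3}. - 2 * lam r j * L j t - (- 2 * lam r j * L j t0))"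
        unfolding Gu sum_distrib_left by (intro sum.cong refl) algebra
      also have "\<dots> = (\<Sum>j\<in>{1,2,3}. - 2 * lam r j * L j t)
                    - (\<Sum>j\<in>{1,2,3}. - 2 * lam r j * L j t0)"
        by (rule sum_subtractf)
      finally have "exp (- 2 * G (u t)) = (\<Prod>j\<in>{1,2,3}. exp (- 2 * lam r j * L j t))
                    / (\<Prod>j\<in>{1,2,3}. exp (- 2 * lam r j * L j t0))"
        by (simp only: exp_diff exp_sum finite.intros)
      then show ?case using rel elim(2) t0 by simp
    qed
  qed
  moreover have "exp (- 2 * G (u t0)) = (1 - \<kappa> * t0) / (1 - \<kappa> * t0)"
    using nz by (simp add: G0)
  ultimately have "(u has_field_derivative - \<kappa> / (1 - \<kappa> * t0) / (- 2 / P)) (at t0 within S)"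
    by (intro has_field_derivative_implicit[OF _ _ u]) 
  moreover have "- \<kappa> / (1 - \<kappa> * t0) / (- 2 / P) = \<kappa> / 2 * P / (1 - \<kappa> * t0)"
    using P nz by (simp add: field_simps)
  ultimately show ?thesis unfolding P_def by (simp only:)
qed

text \<open>
  Near \<open>v0\<close> the weighted sum \<open>G\<close> of principal logarithms is analytic with nonzero derivative, hence
  has an analytic inverse \<open>g\<close>; the solution is \<open>u t = g (- Ln (1 - \<kappa> t) / 2)\<close>.
\<close>

lemma implicit_relation_solvable:
  assumes inj: "inj_on r {1, 2, 3}" and init: "\<forall>j\<in>{1,2,3}. v0 \<noteq> r j"
  obtains \<epsilon> u where "\<epsilon> > 0" "u 0 = v0" "continuous_on (ball 0 \<epsilon>) u"
    "\<forall>t\<in>ball 0 \<epsilon>. Re (1 - \<kappa> * t) > 0"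
    "\<forall>t\<in>ball 0 \<epsilon>. \<forall>j\<in>{1,2,3}. Re ((u t - r j) / (v0 - r j)) > 0"
    "\<forall>t\<in>ball 0 \<epsilon>. (\<Sum>j\<in>{1,2,3}. lam r j * Ln ((u t - r j) / (v0 - r j))) = - Ln (1 - \<kappa> * t) / 2"
proof -
  define G where "G = (\<lambda>v. \<Sum>j\<in>{1,2,3}. lam r j * Ln ((v - r j) / (v0 - r j)))"
  define T where "T = (\<Inter>j\<in>{1,2,3}. {v. Re ((v - r j) / (v0 - r j)) > 0})"
  have T: "open T"
    unfolding T_def using init
    by (intro open_INT open_Collect_less ballI continuous_intros) auto
  have v0: "v0 \<in> T" using init by (simp add: T_def)
  have der: "(G has_field_derivative 1 / (\<Prod>j\<in>{1,2,3}. v - r j)) (at v)" if "v \<in> T" for v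
    unfolding G_def using that
    by (intro sum_log_has_derivative[OF inj init]) (auto simp: T_def complex_nonpos_Reals_iff)
  then have hol: "G holomorphic_on T"
    using T by (auto simp: holomorphic_on_open)
  have "deriv G v0 \<noteq> 0"
    using DERIV_imp_deriv[OF der[OF v0]] init by simp
  then obtain \<rho> where \<rho>: "\<rho> > 0" "ball v0 \<rho> \<subseteq> T" "open (G ` ball v0 \<rho>)" "inj_on G (ball v0 \<rho>)"
    using has_complex_derivative_locally_invertible[OF hol v0 T] by blast
  obtain g where g: "g holomorphic_on (G ` ball v0 \<rho>)"
      "\<And>z. z \<in> ball v0 \<rho> \<Longrightarrow> deriv G z * deriv g (G z) = 1"
      "\<And>z. z \<in> ball v0 \<rho> \<Longrightarrow> g (G z) = z"
    by (rule holomorphic_has_inverse[OF holomorphic_on_subset[OF hol \<rho>(2)] open_ball \<rho>(4)], rule that)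
  define h where "h = (\<lambda>t. - Ln (1 - \<kappa> * t) / 2)"
  define V where "V = {t. Re (1 - \<kappa> * t) > 0}"
  have V: "open V"
    unfolding V_def by (intro open_Collect_less continuous_intros)
  have h: "continuous_on V h"
    unfolding h_def V_def by (intro continuous_intros) (auto simp: complex_nonpos_Reals_iff)
  have "open (V \<inter> h -` (G ` ball v0 \<rho>))"
    using continuous_open_preimage[OF h V \<rho>(3)] .
  moreover have G0: "G v0 = 0" using init by (simp add: G_def)
  then have "0 \<in> G ` ball v0 \<rho>" using \<rho>(1) by (metis centre_in_ball imageI)
  then have "0 \<in> V \<inter> h -` (G ` ball v0 \<rho>)"
    by (simp add: V_def h_def)
  ultimately obtain \<epsilon> where \<epsilon>: "\<epsilon> > 0" "ball 0 \<epsilon> \<subseteq> V \<inter> h -` (G ` ball v0 \<rho>)"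
    by (meson openE)
  have gh: "g (h t) \<in> T \<and> G (g (h t)) = h t" if "t \<in> ball 0 \<epsilon>" for t
  proof -
    obtain z where "z \<in> ball v0 \<rho>" "h t = G z" using \<epsilon>(2) \<open>t \<in> ball 0 \<epsilon>\<close> by blast
    then show ?thesis using g(3) \<rho>(2) by auto
  qed
  show thesis
  proof
    show "\<epsilon> > 0" by fact
    show "g (h 0) = v0"
      using g(3)[of v0] \<rho>(1) G0 by (simp add: h_def)
    show "continuous_on (ball 0 \<epsilon>) (\<lambda>t. g (h t))"
      using \<epsilon>(2) by (intro continuous_on_compose2[OF holomorphic_on_imp_continuous_on[OF g(1)]]
          continuous_on_subset[OF h]) auto
    show "\<forall>t\<in>ball 0 \<epsilon>. Re (1 - \<kappa> * t) > 0"
      using \<epsilon>(2) by (auto simp: V_def)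
    show "\<forall>t\<in>ball 0 \<epsilon>. \<forall>j\<in>{1,2,3}. Re ((g (h t) - r j) / (v0 - r j)) > 0"
      using gh unfolding T_def by blast
    show "\<forall>t\<in>ball 0 \<epsilon>. (\<Sum>j\<in>{1,2,3}. lam r j * Ln ((g (h t) - r j) / (v0 - r j))) = - Ln (1 - \<kappa> * t) / 2"
      using gh unfolding G_def h_def by blast
  qed
qed

section \<open>The solution of the initial-value problem\<close>

lemma power_branch_principal:
  assumes "continuous_on S f" "f 0 = 1" "\<forall>t\<in>S. Re (f t) > 0"
  shows "power_branch S f p (\<lambda>t. exp (p * Ln (f t)))"
proof -
  have "f t \<noteq> 0" if "t \<in> S" for t using assms(3) that by auto
  moreover have "continuous_on S (\<lambda>t. Ln (f t))"
    using assms by (intro continuous_intros) (auto simp: complex_nonpos_Reals_iff)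
  ultimately show ?thesis
    unfolding power_branch_def using assms(2) by (intro exI[of _ "\<lambda>t. Ln (f t)"]) auto
qed

lemma described_solution_exists:
  assumes inj: "inj_on r {1, 2, 3}"
    and y0: "a1 * x10 + a2 * x20 \<noteq> 0"
    and init: "\<forall>j\<in>{1,2,3}. (b1 * x10 + b2 * x20) / (a1 * x10 + a2 * x20) \<noteq> r j"
  shows "\<exists>\<epsilon>>0. \<exists>x1 x2. described_solution a1 a2 b1 b2 r x10 x20 (ball 0 \<epsilon>) x1 x2"
proof -
  define y0 where "y0 = a1 * x10 + a2 * x20"
  define v0 where "v0 = (b1 * x10 + b2 * x20) / y0"
  define d where "d = a1 * b2 - a2 * b1"
  have init': "\<forall>j\<in>{1,2,3}. v0 \<noteq> r j" using init by (simp add: v0_def y0_def)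
  obtain \<epsilon> u where \<epsilon>: "\<epsilon> > 0" and u: "u 0 = v0" "continuous_on (ball 0 \<epsilon>) u"
    and pos: "\<forall>t\<in>ball 0 \<epsilon>. Re (1 - 2 * y0\<^sup>2 * t) > 0"
      "\<forall>t\<in>ball 0 \<epsilon>. \<forall>j\<in>{1,2,3}. Re ((u t - r j) / (v0 - r j)) > 0"
    and rel: "\<forall>t\<in>ball 0 \<epsilon>. (\<Sum>j\<in>{1,2,3}. lam r j * Ln ((u t - r j) / (v0 - r j)))
                = - Ln (1 - 2 * y0\<^sup>2 * t) / 2"
    using implicit_relation_solvable[OF inj init', of "2 * y0\<^sup>2"] by blast
  define R where "R = (\<lambda>t. exp (- 1 / 2 * Ln (1 - 2 * y0\<^sup>2 * t)))"
  define q where "q = (\<lambda>j t. exp (- 2 * lam r j * Ln ((u t - r j) / (u 0 - r j))))"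
  define y where "y = (\<lambda>t. y0 * R t)"
  define w where "w = (\<lambda>t. u t * y t)"
  define x1 where "x1 = (\<lambda>t. (b2 * y t - a2 * w t) / d)"
  define x2 where "x2 = (\<lambda>t. - (b1 * y t - a1 * w t) / d)"
  have "power_branch (ball 0 \<epsilon>) (\<lambda>t. 1 - 2 * y0\<^sup>2 * t) (- 1 / 2) R"
    unfolding R_def using pos(1) by (intro power_branch_principal continuous_intros) auto
  moreover have "\<forall>j\<in>{1,2,3}. power_branch (ball 0 \<epsilon>) (\<lambda>t. (u t - r j) / (u 0 - r j))
                          (- 2 * lam r j) (q j)"
    unfolding q_def using pos(2) u init'
    by (intro ballI power_branch_principal continuous_intros) auto
  moreover have "(\<Prod>j\<in>{1,2,3::nat}. q j t) = 1 - 2 * y0\<^sup>2 * t" if t: "t \<in> ball 0 \<epsilon>" for t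
  proof -
    have "(\<Prod>j\<in>{1,2,3::nat}. q j t) = exp (- 2 * (\<Sum>j\<in>{1,2,3}. lam r j * Ln ((u t - r j) / (v0 - r j))))"
      unfolding q_def u(1) sum_distrib_left by (simp only: exp_sum finite.intros mult.assoc)
    also have "\<dots> = exp (Ln (1 - 2 * y0\<^sup>2 * t))"
      using rel t by simp
    also have "\<dots> = 1 - 2 * y0\<^sup>2 * t"
    proof (rule exp_Ln)
      have "Re (1 - 2 * y0\<^sup>2 * t) > 0" using pos(1) t by blast
      then show "1 - 2 * y0\<^sup>2 * t \<noteq> 0" by force
    qed
    finally show ?thesis .
  qed
  ultimately have "described_solution a1 a2 b1 b2 r x10 x20 (ball 0 \<epsilon>) x1 x2"
    unfolding described_solution_def Let_def y0_def[symmetric] d_def[symmetric]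
    by (intro exI[of _ y] exI[of _ w] exI[of _ u] exI[of _ R] exI[of _ q])
      (simp add: x1_def x2_def y_def w_def u(1) v0_def)
  then show ?thesis using \<epsilon> by blast
qed

lemma cubic_rhs_linear_forms:
  assumes d: "a1 * b2 - a2 * b1 \<noteq> 0" and par: "parametrized c a1 a2 b1 b2 \<gamma>1 \<gamma>2 \<gamma>3"
    and x1: "x1 = (b2 * y - a2 * w) / (a1 * b2 - a2 * b1)"
    and x2: "x2 = - (b1 * y - a1 * w) / (a1 * b2 - a2 * b1)"
  defines "w' \<equiv> w ^ 3 + \<gamma>1 * w\<^sup>2 * y + \<gamma>2 * w * y\<^sup>2 + \<gamma>3 * y ^ 3"
  shows "cubic_rhs c 1 x1 x2 = (b2 * y ^ 3 - a2 * w') / (a1 * b2 - a2 * b1)"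
    and "cubic_rhs c 2 x1 x2 = - (b1 * y ^ 3 - a1 * w') / (a1 * b2 - a2 * b1)"
proof -
  have "x1 = (y * b2 - a2 * w) / (a1 * b2 - a2 * b1)" "x2 = (- y * b1 + a1 * w) / (a1 * b2 - a2 * b1)"
    unfolding x1 x2 by (simp_all add: mult.commute)
  then have yw: "y = a1 * x1 + a2 * x2" "w = b1 * x1 + b2 * x2"
    using cramer_2x2[OF d, of x1 y w x2] by simp_all
  note rel = par[unfolded parametrized_iff[OF d]]
  have "a1 * cubic_rhs c 1 x1 x2 + a2 * cubic_rhs c 2 x1 x2 = y ^ 3"
    using rel unfolding yw cubic_rhs_def cubing_form_def by algebra
  moreover have "b1 * cubic_rhs c 1 x1 x2 + b2 * cubic_rhs c 2 x1 x2 = w'"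
    using rel unfolding w'_def yw cubic_rhs_def K1_def K2_def K3_def K4_def by algebra
  ultimately have "cubic_rhs c 1 x1 x2 = (y ^ 3 * b2 - a2 * w') / (a1 * b2 - a2 * b1)"
    "cubic_rhs c 2 x1 x2 = (- (y ^ 3) * b1 + a1 * w') / (a1 * b2 - a2 * b1)"
    using cramer_2x2[OF d, of "cubic_rhs c 1 x1 x2" "y ^ 3" w' "cubic_rhs c 2 x1 x2"] by simp_all
  then show "cubic_rhs c 1 x1 x2 = (b2 * y ^ 3 - a2 * w') / (a1 * b2 - a2 * b1)"
    "cubic_rhs c 2 x1 x2 = - (b1 * y ^ 3 - a1 * w') / (a1 * b2 - a2 * b1)"
    by (simp_all add: mult.commute)
qed

lemma has_field_derivative_cong_on:
  assumes "(f has_field_derivative D) (at t within S)" "t \<in> S" "\<And>s. s \<in> S \<Longrightarrow> f s = g s"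
  shows "(g has_field_derivative D) (at t within S)"
  by (rule has_field_derivative_transform_within[OF assms(1) zero_less_one assms(2)]) (rule assms(3))

text \<open>
  Differentiating the logarithm \<open>M\<close> of \<open>1 - 2 y0^2 t\<close> gives \<open>y' = y^3\<close>, and the implicit relation gives
  \<open>u' = P(u) y^2\<close> with \<open>P(u) = u^3 + \<gamma>1 u^2 + (\<gamma>2 - 1) u + \<gamma>3\<close>. Then \<open>w = u y\<close> satisfies
  \<open>w' = (P(u) + u) y^3\<close>; the shift of \<open>\<gamma>2\<close> by 1 in \<open>P\<close> absorbs the term \<open>u y'\<close>.
\<close>

lemma described_solution_solves:
  assumes d: "a1 * b2 - a2 * b1 \<noteq> 0" and par: "parametrized c a1 a2 b1 b2 \<gamma>1 \<gamma>2 \<gamma>3"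
    and roots: "cubic_roots \<gamma>1 \<gamma>2 \<gamma>3 r" and inj: "inj_on r {1, 2, 3}"
    and y0: "a1 * x10 + a2 * x20 \<noteq> 0"
    and init: "\<forall>j\<in>{1,2,3}. (b1 * x10 + b2 * x20) / (a1 * x10 + a2 * x20) \<noteq> r j"
    and S0: "0 \<in> S"
    and sol: "described_solution a1 a2 b1 b2 r x10 x20 S x1 x2"
  shows "solves_ivp c x10 x20 S x1 x2"
proof -
  define d where "d = a1 * b2 - a2 * b1"
  define y0 where "y0 = a1 * x10 + a2 * x20"
  define w0 where "w0 = b1 * x10 + b2 * x20"
  note d = d[folded d_def] and y0 = y0[folded y0_def]
  obtain y w u R q where
    R: "power_branch S (\<lambda>t. 1 - 2 * y0\<^sup>2 * t) (- 1 / 2) R"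
    and y: "\<forall>t\<in>S. y t = y0 * R t" and u0: "u 0 = w0 / y0"
    and q: "\<forall>j\<in>{1,2,3}. power_branch S (\<lambda>t. (u t - r j) / (u 0 - r j)) (- 2 * lam r j) (q j)"
    and rel: "\<forall>t\<in>S. (\<Prod>j\<in>{1,2,3::nat}. q j t) = 1 - 2 * y0\<^sup>2 * t"
    and w: "\<forall>t\<in>S. w t = u t * y t"
    and x: "\<forall>t\<in>S. x1 t = (b2 * y t - a2 * w t) / d \<and> x2 t = - (b1 * y t - a1 * w t) / d"
    using sol unfolding described_solution_def Let_def y0_def d_def w0_def by blast
  obtain M where M: "continuous_on S M" "M 0 = 0"
    "\<forall>t\<in>S. exp (M t) = 1 - 2 * y0\<^sup>2 * t \<and> R t = exp (- 1 / 2 * M t)"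
    using R unfolding power_branch_def by blast
  obtain L where L: "\<forall>j\<in>{1,2,3}. continuous_on S (L j) \<and> L j 0 = 0 \<and>
     (\<forall>t\<in>S. exp (L j t) = (u t - r j) / (u 0 - r j) \<and> q j t = exp (- 2 * lam r j * L j t))"
    using bchoice[OF q[unfolded power_branch_def]] by blast
  have init': "\<forall>j\<in>{1,2,3}. u 0 \<noteq> r j"
    using init unfolding u0 w0_def y0_def .
  have q_prod: "\<forall>t\<in>S. (\<Prod>j\<in>{1,2,3}. exp (- 2 * lam r j * L j t)) = 1 - 2 * y0\<^sup>2 * t"
    using rel L by simp
  have "x1 0 = x10 \<and> x2 0 = x20"
  proof -
    have "y 0 = y0" "w 0 = w0" using y w M S0 u0 y0 by simp_all
    then have "x1 0 = (y0 * b2 - a2 * w0) / d \<and> x2 0 = (- y0 * b1 + a1 * w0) / d"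
      using x S0 by (simp add: mult.commute)
    moreover have "x10 = (y0 * b2 - a2 * w0) / d \<and> x20 = (- y0 * b1 + a1 * w0) / d"
      unfolding d_def using cramer_2x2[OF d[unfolded d_def], of x10 y0 w0 x20] by (simp add: y0_def w0_def)
    ultimately show ?thesis by simp
  qed
  moreover have "(x1 has_field_derivative cubic_rhs c 1 (x1 t) (x2 t)) (at t within S) \<and>
      (x2 has_field_derivative cubic_rhs c 2 (x1 t) (x2 t)) (at t within S)" if t: "t \<in> S" for t
  proof -
    have expM: "exp (M t) = 1 - 2 * y0\<^sup>2 * t" using M t by blast
    then have nz: "1 - 2 * y0\<^sup>2 * t \<noteq> 0" by (metis exp_not_eq_zero)
    have "exp (- 1 / 2 * M t) ^ 2 * exp (M t) = 1"
      by (simp only: exp_double[symmetric] exp_add[symmetric]) simp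
    then have "(y t)\<^sup>2 * (1 - 2 * y0\<^sup>2 * t) = y0\<^sup>2"
      using y M t unfolding expM by (simp add: power_mult_distrib)
    then have y_sq: "(y t)\<^sup>2 = y0\<^sup>2 / (1 - 2 * y0\<^sup>2 * t)"
      using nz by (simp add: nonzero_eq_divide_eq)
    have "(M has_field_derivative - 2 * y0\<^sup>2 / exp (M t)) (at t within S)"
    proof (rule has_field_derivative_implicit)
      show "(exp has_field_derivative exp (M t)) (at (M t))" by (rule DERIV_exp)
      show "continuous (at t within S) M"
        using M(1) t by (simp add: continuous_on_eq_continuous_within)
      show "((\<lambda>t. 1 - 2 * y0\<^sup>2 * t) has_field_derivative - 2 * y0\<^sup>2) (at t within S)"
        by (auto intro!: derivative_eq_intros)
      show "\<forall>\<^sub>F s in at t within S. exp (M s) = 1 - 2 * y0\<^sup>2 * s"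
        using M(3) by (simp add: eventually_at_filter)
    qed (use expM in auto)
    then have "(M has_field_derivative - 2 * (y t)\<^sup>2) (at t within S)"
      unfolding expM y_sq by simp
    then have "((\<lambda>t. y0 * exp (- 1 / 2 * M t)) has_field_derivative
       y0 * exp (- 1 / 2 * M t) * (y t)\<^sup>2) (at t within S)"
      by (auto intro!: derivative_eq_intros)
    moreover have y_exp: "y0 * exp (- 1 / 2 * M s) = y s" if "s \<in> S" for s
      using y M that by simp
    ultimately have "(y has_field_derivative y t * (y t)\<^sup>2) (at t within S)"
      unfolding y_exp[OF t] by (rule has_field_derivative_cong_on[OF _ t])
    then have y': "(y has_field_derivative y t ^ 3) (at t within S)"
      by (rule DERIV_cong) algebra
    have "(u has_field_derivative 2 * y0\<^sup>2 / 2 * (\<Prod>j\<in>{1,2,3}. u t - r j) / (1 - 2 * y0\<^sup>2 * t))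
           (at t within S)"
      by (rule implicit_relation_derivative[OF inj init' _ _ q_prod t]) (use L in blast)+
    moreover have "2 * y0\<^sup>2 / 2 * (\<Prod>j\<in>{1,2,3}. u t - r j) / (1 - 2 * y0\<^sup>2 * t)
        = (\<Prod>j\<in>{1,2,3}. u t - r j) * (y t)\<^sup>2"
      unfolding y_sq by simp
    moreover have "(\<Prod>j\<in>{1,2,3}. u t - r j) = u t ^ 3 + \<gamma>1 * (u t)\<^sup>2 + (\<gamma>2 - 1) * u t + \<gamma>3"
    proof -
      have "(\<Prod>j\<in>{1,2,3}. u t - r j) = (u t - r 1) * (u t - r 2) * (u t - r 3)"
        by (simp add: mult.assoc)
      also have "\<dots> = u t ^ 3 + \<gamma>1 * (u t)\<^sup>2 + (\<gamma>2 - 1) * u t + \<gamma>3"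
        using roots unfolding cubic_roots_iff by algebra
      finally show ?thesis .
    qed
    ultimately have u': "(u has_field_derivative
        (u t ^ 3 + \<gamma>1 * (u t)\<^sup>2 + (\<gamma>2 - 1) * u t + \<gamma>3) * (y t)\<^sup>2) (at t within S)"
      by (simp only:)
    define w' where "w' = w t ^ 3 + \<gamma>1 * (w t)\<^sup>2 * y t + \<gamma>2 * w t * (y t)\<^sup>2 + \<gamma>3 * y t ^ 3"
    have wt: "w t = u t * y t" using w t by blast
    have "((\<lambda>t. u t * y t) has_field_derivative w') (at t within S)"
      by (rule DERIV_cong[OF DERIV_mult[OF u' y']]) (unfold w'_def wt, algebra)
    then have uy': "((\<lambda>t. u t * y t) has_field_derivative w') (at t within S)" .
    have "((\<lambda>t. (b2 * y t - a2 * (u t * y t)) / d) has_field_derivative (b2 * y t ^ 3 - a2 * w') / d) (at t within S)"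
      "((\<lambda>t. - (b1 * y t - a1 * (u t * y t)) / d) has_field_derivative - (b1 * y t ^ 3 - a1 * w') / d) (at t within S)"
      by (intro DERIV_cdivide DERIV_minus DERIV_diff DERIV_cmult y' uy')+
    moreover have "(b2 * y s - a2 * (u s * y s)) / d = x1 s" "- (b1 * y s - a1 * (u s * y s)) / d = x2 s"
      if "s \<in> S" for s
      using x w that by simp_all
    ultimately have "(x1 has_field_derivative (b2 * y t ^ 3 - a2 * w') / d) (at t within S)"
      "(x2 has_field_derivative - (b1 * y t ^ 3 - a1 * w') / d) (at t within S)"
      by (blast intro: has_field_derivative_cong_on[OF _ t])+
    moreover have "cubic_rhs c 1 (x1 t) (x2 t) = (b2 * y t ^ 3 - a2 * w') / d"
      "cubic_rhs c 2 (x1 t) (x2 t) = - (b1 * y t ^ 3 - a1 * w') / d"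
      unfolding w'_def d_def using x t
      by (intro cubic_rhs_linear_forms[OF d[unfolded d_def] par]; simp add: d_def)+
    ultimately show ?thesis by (simp only: simp_thms)
  qed
  ultimately show ?thesis unfolding solves_ivp_def by blast
qed

lemma constraints_give_solution:
  assumes gen: "generic_coeffs c" and "common_root_det c = 0" "constraint2 c"
  shows "has_described_ivp_solution c"
proof -
  obtain a1 a2 b1 b2 \<gamma>1 \<gamma>2 \<gamma>3
    where adm: "admissible_params a1 a2 b1 b2" and par: "parametrized c a1 a2 b1 b2 \<gamma>1 \<gamma>2 \<gamma>3"
    using obtain_parametrization[OF assms] by blast
  obtain r where r: "cubic_roots \<gamma>1 \<gamma>2 \<gamma>3 r"
    by (rule obtain_cubic_roots)
  have inj: "inj_on r {1, 2, 3}"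
    by (rule cubic_roots_distinct[OF gen adm par r])
  have d: "a1 * b2 - a2 * b1 \<noteq> 0" using adm by (simp add: admissible_params_def)
  show ?thesis
    unfolding has_described_ivp_solution_def
  proof (intro exI[of _ a1] exI[of _ a2] exI[of _ b1] exI[of _ b2]
      exI[of _ \<gamma>1] exI[of _ \<gamma>2] exI[of _ \<gamma>3] exI[of _ r] conjI allI impI adm par r inj; elim conjE)
    fix x10 x20 :: complex
    assume init: "a1 * x10 + a2 * x20 \<noteq> 0"
      "\<forall>j\<in>{1,2,3}. (b1 * x10 + b2 * x20) / (a1 * x10 + a2 * x20) \<noteq> r j"
    show "\<exists>\<epsilon>>0. \<exists>x1 x2. described_solution a1 a2 b1 b2 r x10 x20 (ball 0 \<epsilon>) x1 x2"
      by (rule described_solution_exists[OF inj init])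
    show "solves_ivp c x10 x20 S x1 x2"
      if "0 \<in> S" "described_solution a1 a2 b1 b2 r x10 x20 S x1 x2" for S x1 x2
      by (rule described_solution_solves[OF d par r inj init that])
  qed
qed

text \<open>
  For \<open>c11 = c22 = 2\<close>, \<open>c12 = c23 = 1\<close>, \<open>c13 = c24 = 2\<close>, \<open>c14 = c21 = 1\<close> the polynomial of the invariant
  lines is \<open>s^4 - 1\<close>. Among coefficients that give \<open>s^4 - 1\<close> in this way, \<open>c13 = c11\<close> makes the
  determinant vanish, while the second constraint then requires \<open>4 c11^2 = (c12 - 3)^2\<close> unless
  \<open>c12 = -3\<close>.
\<close>

lemma constraint1_without_constraint2:
  "\<exists>c. generic_coeffs c \<and> constraint1_v1 c \<and> \<not> constraint2 c"
proof -
  define c :: "nat \<Rightarrow> nat \<Rightarrow> complex" where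
    "c = (\<lambda>n l. if even (n + l) then 2 else 1)"
  have "rsquarefree (invariant_lines_poly c)"
    unfolding rsquarefree_roots by (auto simp: invariant_lines_poly_def c_def pderiv_pCons)
  moreover have "c 1 1 * c 2 2 \<noteq> c 1 2 * c 2 1"
    by (simp add: c_def)
  then have "\<exists>i\<in>{1..4}. \<exists>j\<in>{1..4}. c 1 i * c 2 j \<noteq> c 1 j * c 2 i"
    by (intro bexI[of _ 1] bexI[of _ 2]) auto
  ultimately have "generic_coeffs c"
    by (simp add: generic_coeffs_def) (simp add: c_def)
  moreover have "constraint1_v1 c" "\<not> constraint2 c"
    by (simp_all add: constraint1_v1_def constraint2_def c_def)
  ultimately show ?thesis by blast
qed

theorem mainTheorem4:
  shows
    "(\<forall>c a1 a2 b1 b2 \<gamma>1 \<gamma>2 \<gamma>3.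
        admissible_params a1 a2 b1 b2 \<and> parametrized c a1 a2 b1 b2 \<gamma>1 \<gamma>2 \<gamma>3 \<longrightarrow>
        constraint1_v1 c \<and> constraint1_v2 c \<and> constraint1_v3 c \<and> constraint2 c)
   \<and> (\<forall>c. generic_coeffs c \<longrightarrow>
        (constraint1_v1 c \<longleftrightarrow> constraint1_v2 c) \<and> (constraint1_v2 c \<longleftrightarrow> constraint1_v3 c))
   \<and> \<not> (\<forall>c. generic_coeffs c \<longrightarrow> (constraint1_v1 c \<longleftrightarrow> constraint2 c))
   \<and> (\<forall>c. generic_coeffs c \<and> (constraint1_v1 c \<or> constraint1_v2 c \<or> constraint1_v3 c) \<and>
        constraint2 c \<longrightarrow> has_described_ivp_solution c)"
proof -
  have necessary: "common_root_det c = 0 \<and> constraint2 c"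
    if adm: "admissible_params a1 a2 b1 b2" and par: "parametrized c a1 a2 b1 b2 \<gamma>1 \<gamma>2 \<gamma>3"
    for c a1 a2 b1 b2 \<gamma>1 \<gamma>2 \<gamma>3
  proof -
    have d: "a1 * b2 - a2 * b1 \<noteq> 0" and a: "a1 \<noteq> 0" "a2 \<noteq> 0"
      using adm by (simp_all add: admissible_params_def)
    show ?thesis
      using cubing_form_constraints[OF _ a] par[unfolded parametrized_iff[OF d]] by blast
  qed
  have versions: "(constraint1_v1 c \<longleftrightarrow> common_root_det c = 0) \<and> (constraint1_v2 c \<longleftrightarrow> common_root_det c = 0)
      \<and> (constraint1_v3 c \<longleftrightarrow> common_root_det c = 0)" if "generic_coeffs c" for c
    using that by (simp add: generic_coeffs_def constraint1_v1_iff constraint1_v2_iff constraint1_v3_iff)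
  show ?thesis
  proof (intro conjI)
    show "\<forall>c a1 a2 b1 b2 \<gamma>1 \<gamma>2 \<gamma>3.
        admissible_params a1 a2 b1 b2 \<and> parametrized c a1 a2 b1 b2 \<gamma>1 \<gamma>2 \<gamma>3 \<longrightarrow>
        constraint1_v1 c \<and> constraint1_v2 c \<and> constraint1_v3 c \<and> constraint2 c"
      using necessary by (auto simp: constraint1_v1_iff constraint1_v2_iff constraint1_v3_iff)
    show "\<forall>c. generic_coeffs c \<longrightarrow>
        (constraint1_v1 c \<longleftrightarrow> constraint1_v2 c) \<and> (constraint1_v2 c \<longleftrightarrow> constraint1_v3 c)"
      using versions by blast
    show "\<not> (\<forall>c. generic_coeffs c \<longrightarrow> (constraint1_v1 c \<longleftrightarrow> constraint2 c))"
      using constraint1_without_constraint2 by blast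
    show "\<forall>c. generic_coeffs c \<and> (constraint1_v1 c \<or> constraint1_v2 c \<or> constraint1_v3 c) \<and>
        constraint2 c \<longrightarrow> has_described_ivp_solution c"
      using versions constraints_give_solution by blast
  qed
qed

end
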